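(* Let $n\ge 1$ and let $\Delta(\mathbf{x},B)$ be a cluster complex of $A_n$ type. Suppose that the quiver $Q_B$ is, up to relabeling its vertices, the linearly oriented quiver $$1\to 2\to 3\to\cdots\to n-1\to n .$$ Then $\Delta^+(\mathbf{x},B)$ is isomorphic to the cone of $\Delta(A_{n-1})$.
   Context: Seeds and mutation. Let $\mathcal F$ be a field of rational functions in $n$ indeterminates over $\mathbb Q$. A labeled seed is a pair $(\mathbf{x},B)$ where $\mathbf{x}=(x_1,\dots,x_n)$ is a free generating set of $\mathcal F$ (the cluster; its elements are cluster variables) and $B=(b_{ij})$ is a skew-symmetrizable $n\times n$ integer matrix. With $[b]_+=\max(b,0)$, the mutation in direction $k$ sends $(\mathbf{x},B)$ to $(\mathbf{x}',B')$ with $b'_{ij}=-b_{ij}$ if $i=k$ or $j=k$, and $b'_{ij}=b_{ij}+[b_{ik}]_+b_{kj}+b_{ik}[-b_{kj}]_+$ otherwise; $x'_j=x_j$ for $j\ne k$ and $x'_k=\big(\prod_i x_i^{[b_{ik}]_+}+\prod_i x_i^{[-b_{ik}]_+}\big)/x_k$. Cluster complexes. The cluster complex $\Delta(\mathbf{x},B)$ is the simplicial complex whose vertices are all cluster variables of seeds obtained from $(\mathbf{x},B)$ by finite sequences of mutations, and whose simplices are all subsets (including $\emptyset$) of the clusters of these seeds. The positive cluster complex $\Delta^+(\mathbf{x},B)$ is the full subcomplex of $\Delta(\mathbf{x},B)$ on the cluster variables not belonging to the initial cluster $\mathbf{x}$. Quivers and type. For skew-symmetric $B$, $Q_B$ is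 the quiver with vertices $1,\dots,n$ and $b_{ij}$ arrows $i\to j$ whenever $b_{ij}>0$. $\Delta(\mathbf{x},B)$ is of $A_n$ type if $B$ is mutation equivalent (up to relabeling indices) to a matrix $B'$ such that $Q_{B'}$ has the Dynkin diagram $A_n$ as underlying graph; all such complexes are isomorphic and denoted $\Delta(A_n)$; $\Delta(A_0)=\{\emptyset\}$. Cone. For a simplicial complex $L$ and a new vertex $*$, the cone of $L$ has as simplices all $\sigma$ and $\sigma\cup\{*\}$ with $\sigma$ a simplex of $L$ (including $\sigma=\emptyset$). *)

theory Defs
  imports
    Complex_Main
    "HOL-Library.Multiset"
    "HOL-Library.Poly_Mapping"
    "Graph_Theory.Digraph_Isomorphism"
begin

section \<open>Free generating sets of a field over the rationals\<close>

text \<open>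
  Fields are subfields \<open>F\<close> of an ambient field \<open>'a\<close> of characteristic 0, so that fields of
  rational functions in different numbers of indeterminates can live in one type.
  A polynomial over the rationals in the indeterminates \<open>X\<^sub>i\<close> is an element of
  \<open>(nat \<Rightarrow>\<^sub>0 nat) \<Rightarrow>\<^sub>0 rat\<close>, i.e. a finitely supported family of coefficients indexed by exponent
  vectors.
\<close>

definition is_subfield :: "'a::field set \<Rightarrow> bool" where
  "is_subfield K \<longleftrightarrow> 0 \<in> K \<and> 1 \<in> K \<and>
     (\<forall>a\<in>K. \<forall>b\<in>K. a + b \<in> K \<and> a * b \<in> K) \<and> (\<forall>a\<in>K. - a \<in> K \<and> inverse a \<in> K)"

definition poly_vars :: "((nat \<Rightarrow>\<^sub>0 nat) \<Rightarrow>\<^sub>0 rat) \<Rightarrow> nat set" where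
  "poly_vars p = (\<Union>m\<in>Poly_Mapping.keys p. Poly_Mapping.keys m)"

definition poly_eval :: "((nat \<Rightarrow>\<^sub>0 nat) \<Rightarrow>\<^sub>0 rat) \<Rightarrow> (nat \<Rightarrow> 'a::field_char_0) \<Rightarrow> 'a" where
  "poly_eval p x =
     (\<Sum>m\<in>Poly_Mapping.keys p. of_rat (Poly_Mapping.lookup p m) *
        (\<Prod>i\<in>Poly_Mapping.keys m. x i ^ Poly_Mapping.lookup m i))"

definition algebraically_independent :: "nat \<Rightarrow> (nat \<Rightarrow> 'a::field_char_0) \<Rightarrow> bool" where
  "algebraically_independent n x \<longleftrightarrow>
     (\<forall>p. poly_vars p \<subseteq> {1..n} \<and> poly_eval p x = 0 \<longrightarrow> p = 0)"

definition free_generating_set :: "'a::field_char_0 set \<Rightarrow> nat \<Rightarrow> (nat \<Rightarrow> 'a) \<Rightarrow> bool" where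
  "free_generating_set F n x \<longleftrightarrow>
     algebraically_independent n x \<and> F = is_subfield hull (x ` {1..n})"


section \<open>Labeled seeds and mutation\<close>

text \<open>
  Indices range over \<open>{1..n}\<close>; the values of tuples and matrices at other indices are irrelevant
  and are never consulted for indices in that range.
\<close>

type_synonym int_matrix = "nat \<Rightarrow> nat \<Rightarrow> int"
type_synonym 'a seed = "(nat \<Rightarrow> 'a) \<times> int_matrix"

definition skew_symmetric :: "nat \<Rightarrow> int_matrix \<Rightarrow> bool" where
  "skew_symmetric n B \<longleftrightarrow> (\<forall>i\<in>{1..n}. \<forall>j\<in>{1..n}. B i j = - B j i)"

definition skew_symmetrizable :: "nat \<Rightarrow> int_matrix \<Rightarrow> bool" where
  "skew_symmetrizable n B \<longleftrightarrow>
     (\<exists>d :: nat \<Rightarrow> int. (\<forall>i\<in>{1..n}. d i > 0) \<and> skew_symmetric n (\<lambda>i j. d i * B i j))"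

definition labeled_seed :: "'a::field_char_0 set \<Rightarrow> nat \<Rightarrow> 'a seed \<Rightarrow> bool" where
  "labeled_seed F n s \<longleftrightarrow> free_generating_set F n (fst s) \<and> skew_symmetrizable n (snd s)"

definition pos_part :: "int \<Rightarrow> int" where
  "pos_part b = max b 0"

definition mutate_matrix :: "nat \<Rightarrow> int_matrix \<Rightarrow> int_matrix" where
  "mutate_matrix k B = (\<lambda>i j.
     if i = k \<or> j = k then - B i j
     else B i j + pos_part (B i k) * B k j + B i k * pos_part (- B k j))"

definition mutate_cluster ::
    "nat \<Rightarrow> nat \<Rightarrow> (nat \<Rightarrow> 'a::field) \<Rightarrow> int_matrix \<Rightarrow> (nat \<Rightarrow> 'a)" where
  "mutate_cluster n k x B = x(k :=
     ((\<Prod>i\<in>{1..n}. x i ^ nat (pos_part (B i k))) +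
      (\<Prod>i\<in>{1..n}. x i ^ nat (pos_part (- B i k)))) / x k)"

definition mutate_seed :: "nat \<Rightarrow> nat \<Rightarrow> 'a::field seed \<Rightarrow> 'a seed" where
  "mutate_seed n k s = (mutate_cluster n k (fst s) (snd s), mutate_matrix k (snd s))"

inductive_set reachable_seeds :: "nat \<Rightarrow> 'a::field seed \<Rightarrow> 'a seed set"
  for n :: nat and s :: "'a seed" where
  initial: "s \<in> reachable_seeds n s"
| mutate: "t \<in> reachable_seeds n s \<Longrightarrow> k \<in> {1..n} \<Longrightarrow> mutate_seed n k t \<in> reachable_seeds n s"

inductive mutation_equivalent :: "nat \<Rightarrow> int_matrix \<Rightarrow> int_matrix \<Rightarrow> bool"
  for n :: nat and B :: int_matrix where
  initial: "mutation_equivalent n B B"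
| mutate: "mutation_equivalent n B C \<Longrightarrow> k \<in> {1..n} \<Longrightarrow> mutation_equivalent n B (mutate_matrix k C)"

definition mutation_equivalent_up_to_relabeling :: "nat \<Rightarrow> int_matrix \<Rightarrow> int_matrix \<Rightarrow> bool" where
  "mutation_equivalent_up_to_relabeling n B B' \<longleftrightarrow>
     (\<exists>C p. mutation_equivalent n B C \<and> bij_betw p {1..n} {1..n} \<and>
        (\<forall>i\<in>{1..n}. \<forall>j\<in>{1..n}. B' i j = C (p i) (p j)))"


section \<open>Simplicial complexes\<close>

text \<open>
  A simplicial complex is given by its set of simplices, including the empty one; every vertex is
  a simplex, so the vertex set is the union of all simplices.
\<close>

definition vertices :: "'v set set \<Rightarrow> 'v set" where
  "vertices K = \<Union>K"

definition full_subcomplex :: "'v set set \<Rightarrow> 'v set \<Rightarrow> 'v set set" where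
  "full_subcomplex K W = {\<sigma> \<in> K. \<sigma> \<subseteq> W}"

definition complex_isomorphic :: "'v set set \<Rightarrow> 'w set set \<Rightarrow> bool" where
  "complex_isomorphic K L \<longleftrightarrow>
     (\<exists>f. bij_betw f (vertices K) (vertices L) \<and> (\<lambda>\<sigma>. f ` \<sigma>) ` K = L)"

text \<open>The new vertex of the cone is \<open>None\<close>; a vertex \<open>v\<close> of the base becomes \<open>Some v\<close>.\<close>

definition cone :: "'v set set \<Rightarrow> 'v option set set" where
  "cone L = (\<lambda>\<sigma>. Some ` \<sigma>) ` L \<union> (\<lambda>\<sigma>. insert None (Some ` \<sigma>)) ` L"

definition cluster_complex :: "nat \<Rightarrow> 'a::field seed \<Rightarrow> 'a set set" where
  "cluster_complex n s = (\<Union>t\<in>reachable_seeds n s. Pow (fst t ` {1..n}))"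

definition positive_cluster_complex :: "nat \<Rightarrow> 'a::field seed \<Rightarrow> 'a set set" where
  "positive_cluster_complex n s =
     full_subcomplex (cluster_complex n s) (vertices (cluster_complex n s) - fst s ` {1..n})"


section \<open>Quivers and type\<close>

text \<open>
  The arc \<open>(i, j, m)\<close> is the \<open>m\<close>-th of the \<open>B i j\<close> arrows from \<open>i\<close> to \<open>j\<close>. The quiver is only
  meaningful for skew-symmetric \<open>B\<close>.
\<close>

definition quiver :: "nat \<Rightarrow> int_matrix \<Rightarrow> (nat, nat \<times> nat \<times> nat) pre_digraph" where
  "quiver n B =
     \<lparr> verts = {1..n},
       arcs = {(i, j, m). i \<in> {1..n} \<and> j \<in> {1..n} \<and> int m < B i j},
       tail = (\<lambda>(i, j, m). i),
       head = (\<lambda>(i, j, m). j) \<rparr>"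

definition linear_quiver :: "nat \<Rightarrow> (nat, nat) pre_digraph" where
  "linear_quiver n = \<lparr> verts = {1..n}, arcs = {1..<n}, tail = (\<lambda>i. i), head = Suc \<rparr>"

text \<open>Undirected multigraphs: a vertex set together with the multiset of edges.\<close>

definition underlying_graph :: "('v, 'e) pre_digraph \<Rightarrow> 'v set \<times> 'v set multiset" where
  "underlying_graph G =
     (verts G, image_mset (\<lambda>a. {tail G a, head G a}) (mset_set (arcs G)))"

definition dynkin_A :: "nat \<Rightarrow> nat set \<times> nat set multiset" where
  "dynkin_A n = ({1..n}, mset_set ((\<lambda>i. {i, Suc i}) ` {1..<n}))"

text \<open>
  The labels of the diagram may be fixed to be \<open>1, \<dots>, n\<close> along the path, since the indices of
  \<open>B'\<close> are arbitrary up to relabeling.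
\<close>

definition A_type :: "nat \<Rightarrow> int_matrix \<Rightarrow> bool" where
  "A_type n B \<longleftrightarrow>
     (\<exists>B'. mutation_equivalent_up_to_relabeling n B B' \<and> skew_symmetric n B' \<and>
        underlying_graph (quiver n B') = dynkin_A n)"

end

theory Submission
  imports Defs
begin

text \<open>
  The cluster variables of type \<open>A\<^sub>n\<close> are the diagonals of an \<open>(n + 3)\<close>-gon, the clusters are its
  triangulations, and mutations are flips; the exchange relations are Ptolemy relations. The linear
  quiver belongs to the fan of all diagonals at the vertex \<open>0\<close>, so the positive complex consists of
  the noncrossing sets of diagonals that avoid \<open>0\<close>. The diagonal joining the two neighbours of \<open>0\<close>
  crosses none of these and is the apex of the cone; the others are the diagonals of the
  \<open>(n + 2)\<close>-gon cut off by it.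

  That distinct diagonals give distinct cluster variables is seen by specializing the initial
  variables to positive rationals. Being able to specialize a cluster to arbitrary positive values
  is a property that, unlike algebraic independence, is seen at once to be preserved by mutation.
\<close>
section \<open>Specializations of algebraically independent families\<close>

text \<open>A fraction of polynomials has a value at a rational point only if its denominator does
  not vanish there, so evaluation in the field is a partial map; it is kept as its graph. What makes
  this robust is that mutation never subtracts: at a positive point every exchange binomial is
  positive, so no denominator met along a mutation path vanishes. The same remark shows that cluster
  variables are nonzero and that each mutation can be undone, so the complex may be computed from
  any reachable seed. That freedom is needed for the second complex, whose seed lives in an
  unrelated field and whose quiver may be any member of the mutation class: mutations along the
  Dynkin path turn every orientation into the linear one. Both complexes thereby become injectively
  labeled families of noncrossing sets, and the theorem is left as an identity between such
  families.\<close>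

definition monomial :: "(nat \<Rightarrow>\<^sub>0 nat) \<Rightarrow> (nat \<Rightarrow> 'a::field_char_0) \<Rightarrow> 'a" where
  "monomial m x = (\<Prod>i\<in>Poly_Mapping.keys m. x i ^ Poly_Mapping.lookup m i)"

lemma monomial_superset:
  assumes "finite A" "Poly_Mapping.keys m \<subseteq> A"
  shows "monomial m x = (\<Prod>i\<in>A. x i ^ Poly_Mapping.lookup m i)"
  unfolding monomial_def
  by (rule prod.mono_neutral_left) (use assms in \<open>auto simp: in_keys_iff\<close>)

lemma monomial_add: "monomial (m + m') x = monomial m x * monomial m' x"
proof -
  let ?A = "Poly_Mapping.keys m \<union> Poly_Mapping.keys m'"
  have "monomial (m + m') x = (\<Prod>i\<in>?A. x i ^ Poly_Mapping.lookup (m + m') i)"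
    by (rule monomial_superset) (auto dest: set_mp[OF keys_add])
  also have "\<dots> = monomial m x * monomial m' x"
    by (simp add: lookup_add power_add prod.distrib monomial_superset[of ?A])
  finally show ?thesis .
qed

lemma poly_eval_superset:
  assumes "finite A" "Poly_Mapping.keys p \<subseteq> A"
  shows "poly_eval p x = (\<Sum>m\<in>A. of_rat (Poly_Mapping.lookup p m) * monomial m x)"
  unfolding poly_eval_def monomial_def
  by (rule sum.mono_neutral_left) (use assms in \<open>auto simp: in_keys_iff\<close>)

lemma poly_eval_zero [simp]: "poly_eval 0 x = 0"
  by (simp add: poly_eval_def)

lemma poly_eval_single: "poly_eval (Poly_Mapping.single m a) x = of_rat a * monomial m x"
  by (subst poly_eval_superset[of "{m}"]) auto

lemma poly_eval_one [simp]: "poly_eval 1 x = 1"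
  using poly_eval_single[of 0 1 x] by (simp add: monomial_def)

lemma poly_eval_add: "poly_eval (p + q) x = poly_eval p x + poly_eval q x"
proof -
  let ?A = "Poly_Mapping.keys p \<union> Poly_Mapping.keys q"
  have "poly_eval (p + q) x =
      (\<Sum>m\<in>?A. of_rat (Poly_Mapping.lookup (p + q) m) * monomial m x)"
    by (rule poly_eval_superset) (auto dest: set_mp[OF keys_add])
  also have "\<dots> = poly_eval p x + poly_eval q x"
    by (simp add: lookup_add of_rat_add distrib_right sum.distrib poly_eval_superset[of ?A])
  finally show ?thesis .
qed

lemma poly_eval_diff: "poly_eval (p - q) x = poly_eval p x - poly_eval q x"
  using poly_eval_add[of "p - q" q x] by simp

lemma poly_eval_mult: "poly_eval (p * q) x = poly_eval p x * poly_eval q x"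
proof -
  \<comment> \<open>Multiplicativity is linear in each factor, so terms are added one at a time: on
    the right against a single term, then on the left.\<close>
  have single: "poly_eval (Poly_Mapping.single m a * q) x
      = poly_eval (Poly_Mapping.single m a) x * poly_eval q x" for m a and q
  proof (induction q rule: update_induct)
    case const
    show ?case by simp
  next
    case (update f k b)
    have "Poly_Mapping.update k b f = f + Poly_Mapping.single k b"
      using update.hyps
      by (intro poly_mapping_eqI) (auto simp: lookup_update lookup_add lookup_single in_keys_iff when_def)
    then show ?case using update.IH
      by (simp add: distrib_left poly_eval_add mult_single poly_eval_single monomial_add
          of_rat_mult algebra_simps)
  qed
  show ?thesis
  proof (induction p rule: update_induct)
    case const
    show ?case by simp
  next
    case (update f k b)
    have "Poly_Mapping.update k b f = f + Poly_Mapping.single k b"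
      using update.hyps
      by (intro poly_mapping_eqI) (auto simp: lookup_update lookup_add lookup_single in_keys_iff when_def)
    then show ?case using update.IH
      by (simp add: distrib_right poly_eval_add single)
  qed
qed

lemma poly_vars_zero: "poly_vars 0 = {}"
  by (simp add: poly_vars_def)

lemma poly_vars_one: "poly_vars 1 = {}"
  by (simp add: poly_vars_def)

lemma poly_vars_add: "poly_vars (p + q) \<subseteq> poly_vars p \<union> poly_vars q"
  unfolding poly_vars_def using keys_add[of p q] by blast

lemma poly_vars_diff: "poly_vars (p - q) \<subseteq> poly_vars p \<union> poly_vars q"
  unfolding poly_vars_def using keys_diff[of p q] by blast

lemma poly_vars_mult: "poly_vars (p * q) \<subseteq> poly_vars p \<union> poly_vars q"
proof
  fix i
  assume "i \<in> poly_vars (p * q)"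
  then obtain m where m: "m \<in> Poly_Mapping.keys (p * q)" "i \<in> Poly_Mapping.keys m"
    by (auto simp: poly_vars_def)
  then obtain u v where "m = u + v" "u \<in> Poly_Mapping.keys p" "v \<in> Poly_Mapping.keys q"
    using keys_mult[of p q] by blast
  moreover from this m(2) have "i \<in> Poly_Mapping.keys u \<union> Poly_Mapping.keys v"
    using keys_add[of u v] by blast
  ultimately show "i \<in> poly_vars p \<union> poly_vars q"
    by (auto simp: poly_vars_def)
qed

section \<open>Partial evaluation at rational points\<close>

text \<open>The graph of a partial map to the rationals that respects the operations used by
  mutation; the last clause makes it single-valued. Division asks for a nonzero value of the
  divisor, and the divisor itself is then nonzero.\<close>

definition specialization :: "('a::field \<times> rat) set \<Rightarrow> bool" where
  "specialization L \<longleftrightarrow>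
     (0, 0) \<in> L \<and> (1, 1) \<in> L \<and>
     (\<forall>z r w s. (z, r) \<in> L \<and> (w, s) \<in> L \<longrightarrow>
        (z + w, r + s) \<in> L \<and> (z * w, r * s) \<in> L \<and> (s \<noteq> 0 \<longrightarrow> (z / w, r / s) \<in> L)) \<and>
     (\<forall>z r s. (z, r) \<in> L \<and> (z, s) \<in> L \<longrightarrow> r = s)"

text \<open>Positive points are the test set because mutation carries positive values of one cluster
  to positive values of the next, and back.\<close>

definition specializable :: "nat \<Rightarrow> (nat \<Rightarrow> 'a::field) \<Rightarrow> bool" where
  "specializable n x \<longleftrightarrow>
     (\<forall>r. (\<forall>i\<in>{1..n}. r i > 0) \<longrightarrow> (\<exists>L. specialization L \<and> (\<forall>i\<in>{1..n}. (x i, r i) \<in> L)))"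

lemma specialization_zero: "specialization L \<Longrightarrow> (0, 0) \<in> L"
  and specialization_one: "specialization L \<Longrightarrow> (1, 1) \<in> L"
  and specialization_add:
    "specialization L \<Longrightarrow> (z, r) \<in> L \<Longrightarrow> (w, s) \<in> L \<Longrightarrow> (z + w, r + s) \<in> L"
  and specialization_mult:
    "specialization L \<Longrightarrow> (z, r) \<in> L \<Longrightarrow> (w, s) \<in> L \<Longrightarrow> (z * w, r * s) \<in> L"
  and specialization_divide:
    "specialization L \<Longrightarrow> (z, r) \<in> L \<Longrightarrow> (w, s) \<in> L \<Longrightarrow> s \<noteq> 0 \<Longrightarrow> (z / w, r / s) \<in> L"
  and specialization_unique:
    "specialization L \<Longrightarrow> (z, r) \<in> L \<Longrightarrow> (z, s) \<in> L \<Longrightarrow> r = s"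
  unfolding specialization_def by blast+

text \<open>The element 0 already has the value 0, and values are unique.\<close>

lemma specialization_nonzero: "specialization L \<Longrightarrow> (z, r) \<in> L \<Longrightarrow> r \<noteq> 0 \<Longrightarrow> z \<noteq> 0"
  using specialization_unique[of L z r 0] specialization_zero[of L] by auto

lemma specialization_power:
  "specialization L \<Longrightarrow> (z, r) \<in> L \<Longrightarrow> (z ^ m, r ^ m) \<in> L"
  by (induction m) (auto intro: specialization_one specialization_mult)

lemma specialization_prod:
  assumes "specialization L" "\<And>i. i \<in> A \<Longrightarrow> (f i, g i) \<in> L"
  shows "(prod f A, prod g A) \<in> L"
  using assms(2)
  by (induction A rule: infinite_finite_induct)
    (auto intro: specialization_one specialization_mult assms(1))

text \<open>\<open>L\<close> evaluates the local ring of fractions whose denominator does not vanish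
  at \<open>r\<close>. Algebraic independence enters twice: such a denominator is not the zero
  polynomial, hence is nonzero at \<open>x\<close>; and two fractions that agree at \<open>x\<close>
  have a cross difference vanishing at \<open>x\<close>, which is therefore the zero polynomial, so
  they agree at \<open>r\<close>.\<close>

lemma algebraically_independent_specializable:
  fixes x :: "nat \<Rightarrow> 'a::field_char_0"
  assumes "algebraically_independent n x"
  shows "specializable n x"
  unfolding specializable_def
proof (intro allI impI)
  fix r :: "nat \<Rightarrow> rat"
  have x_nonzero: "poly_eval q x \<noteq> 0" if "poly_vars q \<subseteq> {1..n}" "poly_eval q r \<noteq> 0" for q
    using assms that unfolding algebraically_independent_def by force
  define L where "L = {(z, s). \<exists>p q. poly_vars p \<subseteq> {1..n} \<and> poly_vars q \<subseteq> {1..n} \<and>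
    poly_eval q r \<noteq> 0 \<and> z = poly_eval p x / poly_eval q x \<and> s = poly_eval p r / poly_eval q r}"
  have L_I: "(z, s) \<in> L"
    if "poly_vars p \<subseteq> {1..n}" "poly_vars q \<subseteq> {1..n}" "poly_eval q r \<noteq> 0"
      "z = poly_eval p x / poly_eval q x" "s = poly_eval p r / poly_eval q r" for z s p q
    using that unfolding L_def by blast
  note vars = set_mp[OF poly_vars_mult] set_mp[OF poly_vars_add]
  have "specialization L"
    unfolding specialization_def
  proof (intro conjI allI impI; (elim conjE)?)
    show "(0, 0) \<in> L"
      by (rule L_I[of 0 1]) (auto simp: poly_vars_zero poly_vars_one)
    show "(1, 1) \<in> L"
      by (rule L_I[of 1 1]) (auto simp: poly_vars_one)
  next
    fix z s w t
    assume "(z, s) \<in> L" "(w, t) \<in> L"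
    then obtain p q p' q' where pq: "poly_vars p \<subseteq> {1..n}" "poly_vars q \<subseteq> {1..n}"
      "poly_eval q r \<noteq> 0" "z = poly_eval p x / poly_eval q x" "s = poly_eval p r / poly_eval q r"
      and pq': "poly_vars p' \<subseteq> {1..n}" "poly_vars q' \<subseteq> {1..n}"
      "poly_eval q' r \<noteq> 0" "w = poly_eval p' x / poly_eval q' x"
      "t = poly_eval p' r / poly_eval q' r"
      unfolding L_def by blast
    note nonzero = x_nonzero[OF pq(2,3)] x_nonzero[OF pq'(2,3)]
    show "(z + w, s + t) \<in> L"
      by (rule L_I[of "p * q' + p' * q" "q * q'"])
        (use pq pq' nonzero in \<open>auto dest!: vars
          simp: poly_eval_mult poly_eval_add field_simps\<close>)
    show "(z * w, s * t) \<in> L"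
      by (rule L_I[of "p * p'" "q * q'"])
        (use pq pq' in \<open>auto dest!: vars simp: poly_eval_mult\<close>)
    \<comment> \<open>Dividing by \<open>w\<close> moves its numerator \<open>p'\<close> into the
      denominator; \<open>p'\<close> does not vanish at \<open>r\<close> because \<open>t\<close> is
      nonzero.\<close>
    show "(z / w, s / t) \<in> L" if "t \<noteq> 0"
      by (rule L_I[of "p * q'" "q * p'"])
        (use pq pq' that in \<open>auto dest!: vars simp: poly_eval_mult\<close>)
  next
    fix z s t
    assume "(z, s) \<in> L" "(z, t) \<in> L"
    then obtain p q p' q' where pq: "poly_vars p \<subseteq> {1..n}" "poly_vars q \<subseteq> {1..n}"
      "poly_eval q r \<noteq> 0" "z = poly_eval p x / poly_eval q x" "s = poly_eval p r / poly_eval q r"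
      and pq': "poly_vars p' \<subseteq> {1..n}" "poly_vars q' \<subseteq> {1..n}"
      "poly_eval q' r \<noteq> 0" "z = poly_eval p' x / poly_eval q' x"
      "t = poly_eval p' r / poly_eval q' r"
      unfolding L_def by blast
    let ?d = "p * q' - p' * q"
    have "poly_eval ?d x = 0"
      using pq(4) pq'(4) x_nonzero[OF pq(2,3)] x_nonzero[OF pq'(2,3)]
      by (simp add: poly_eval_mult poly_eval_diff field_simps)
    moreover have "poly_vars ?d \<subseteq> {1..n}"
      using pq pq' by (auto dest!: vars set_mp[OF poly_vars_diff])
    ultimately have "?d = 0"
      using assms unfolding algebraically_independent_def by blast
    then have "poly_eval ?d r = 0"
      by (simp only: poly_eval_zero)
    then show "s = t"
      using pq(3) pq'(3) unfolding pq(5) pq'(5)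
      by (simp add: poly_eval_mult poly_eval_diff frac_eq_eq)
  qed
  moreover have "(x i, r i) \<in> L" if "i \<in> {1..n}" for i
  proof (rule L_I[of "Poly_Mapping.single (Poly_Mapping.single i 1) 1" 1])
    show "poly_vars (Poly_Mapping.single (Poly_Mapping.single i 1) 1) \<subseteq> {1..n}"
      using that by (auto simp: poly_vars_def)
  qed (auto simp: poly_eval_single monomial_def poly_vars_one)
  ultimately show "\<exists>L. specialization L \<and> (\<forall>i\<in>{1..n}. (x i, r i) \<in> L)"
    by blast
qed


section \<open>Mutation of seeds\<close>

lemma mutate_matrix_cong:
  assumes "\<And>i j. i \<in> A \<Longrightarrow> j \<in> A \<Longrightarrow> B i j = C i j" "k \<in> A" "i \<in> A" "j \<in> A"
  shows "mutate_matrix k B i j = mutate_matrix k C i j"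
  using assms by (simp add: mutate_matrix_def)

text \<open>The corrections of the two mutations cancel: since \<open>[b]_+ - [-b]_+ = b\<close>,
  the terms with the positive part of the column entry sum to \<open>B i k * B k j\<close>, and
  those with the positive part of the row entry to its negative.\<close>

lemma mutate_matrix_involutive: "mutate_matrix k (mutate_matrix k B) = B"
proof (intro ext)
  fix i j
  have p: "pos_part b = pos_part (- b) + b" for b
    by (simp add: pos_part_def)
  show "mutate_matrix k (mutate_matrix k B) i j = B i j"
    using p[of "B i k"] p[of "B k j"] by (simp add: mutate_matrix_def algebra_simps)
qed

text \<open>The same symmetrizer \<open>d\<close> works: it turns the first correction term at
  \<open>(i, j)\<close> into minus the second one at \<open>(j, i)\<close>, so the two terms
  exchange roles under transposition.\<close>

lemma skew_symmetrizable_mutate: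
  assumes "skew_symmetrizable n B" "k \<in> {1..n}"
  shows "skew_symmetrizable n (mutate_matrix k B)"
proof -
  obtain d :: "nat \<Rightarrow> int" where d: "\<And>i. i \<in> {1..n} \<Longrightarrow> d i > 0"
    and skew: "\<And>i j. i \<in> {1..n} \<Longrightarrow> j \<in> {1..n} \<Longrightarrow> d i * B i j = - (d j * B j i)"
    using assms(1) unfolding skew_symmetrizable_def skew_symmetric_def by blast
  have pos: "d i * pos_part (s * B i j) = d j * pos_part (- (s * B j i))"
    if "i \<in> {1..n}" "j \<in> {1..n}" for i j s
  proof -
    have scale: "c * pos_part b = pos_part (c * b)" if "c > 0" for c b
      using that by (simp add: pos_part_def max_mult_distrib_left)
    have "d i * (s * B i j) = d j * - (s * B j i)"
      using arg_cong[OF skew[OF that], of "(*) s"] by (simp add: algebra_simps)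
    then show ?thesis
      using that d by (simp add: scale del: mult_minus_right)
  qed
  have "d i * mutate_matrix k B i j = - (d j * mutate_matrix k B j i)"
    if ij: "i \<in> {1..n}" "j \<in> {1..n}" for i j
  proof (cases "i = k \<or> j = k")
    case True
    then show ?thesis
      using skew[OF ij] by (auto simp: mutate_matrix_def)
  next
    case False
    have 1: "d i * pos_part (B i k) * B k j = - (d j * B j k * pos_part (- B k i))"
      using pos[OF ij(1) assms(2), of 1] skew[OF ij(2) assms(2)] by simp
    have 2: "d i * B i k * pos_part (- B k j) = - (d j * pos_part (B j k) * B k i)"
      using pos[OF ij(2) assms(2), of 1] skew[OF ij(1) assms(2)] by simp
    show ?thesis
      using False 1 2 skew[OF ij] by (simp add: mutate_matrix_def algebra_simps)
  qed
  then show ?thesis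
    using d unfolding skew_symmetrizable_def skew_symmetric_def by blast
qed

lemma skew_symmetrizable_diagonal:
  assumes "skew_symmetrizable n B" "k \<in> {1..n}"
  shows "B k k = 0"
proof -
  obtain d :: "nat \<Rightarrow> int" where "d k > 0" "d k * B k k = - (d k * B k k)"
    using assms unfolding skew_symmetrizable_def skew_symmetric_def by blast
  then show ?thesis
    by simp
qed

definition exchange :: "nat \<Rightarrow> nat \<Rightarrow> (nat \<Rightarrow> 'a::field) \<Rightarrow> int_matrix \<Rightarrow> 'a" where
  "exchange n k x B = (\<Prod>i\<in>{1..n}. x i ^ nat (pos_part (B i k))) +
      (\<Prod>i\<in>{1..n}. x i ^ nat (pos_part (- B i k)))"

lemma mutate_cluster_exchange: "mutate_cluster n k x B = x(k := exchange n k x B / x k)"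
  by (simp add: mutate_cluster_def exchange_def)

text \<open>Negating column \<open>k\<close> swaps the two products, and \<open>B k k = 0\<close>
  keeps the replaced variable out of both.\<close>

lemma exchange_mutate:
  assumes "B k k = 0"
  shows "exchange n k (x(k := a)) (mutate_matrix k B) = exchange n k x B"
proof -
  have "(\<Prod>i\<in>{1..n}. (x(k := a)) i ^ nat (pos_part (s * mutate_matrix k B i k)))
      = (\<Prod>i\<in>{1..n}. x i ^ nat (pos_part (- s * B i k)))" for s
    by (rule prod.cong) (auto simp: mutate_matrix_def pos_part_def assms)
  from this[of 1] this[of "- 1"] show ?thesis
    by (simp add: exchange_def)
qed

lemma mutate_cluster_involutive:
  assumes "B k k = 0" "x k \<noteq> 0" "exchange n k x B \<noteq> 0"
  shows "mutate_cluster n k (mutate_cluster n k x B) (mutate_matrix k B) = x"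
  using assms by (simp add: mutate_cluster_exchange exchange_mutate)

lemma exchange_pos:
  fixes r :: "nat \<Rightarrow> rat"
  assumes "\<And>i. i \<in> {1..n} \<Longrightarrow> r i > 0"
  shows "exchange n k r B > 0"
  unfolding exchange_def using assms by (intro add_pos_pos prod_pos) auto

lemma specialization_exchange:
  assumes "specialization L" "\<And>i. i \<in> {1..n} \<Longrightarrow> (x i, r i) \<in> L"
  shows "(exchange n k x B, exchange n k r B) \<in> L"
  unfolding exchange_def using assms
  by (intro specialization_add specialization_prod specialization_power) auto

text \<open>The point with all coordinates 1 suffices: variables have the value 1 there and an
  exchange binomial has a positive value.\<close>

lemma specializable_nonzero:
  assumes "specializable n x"
  shows "k \<in> {1..n} \<Longrightarrow> x k \<noteq> 0" and "exchange n k x B \<noteq> 0"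
proof -
  obtain L where L: "specialization L" "\<And>i. i \<in> {1..n} \<Longrightarrow> (x i, 1) \<in> L"
    using assms[unfolded specializable_def, rule_format, of "\<lambda>_. 1"] by auto
  show "k \<in> {1..n} \<Longrightarrow> x k \<noteq> 0"
    using specialization_nonzero[OF L(1) L(2)] by simp
  have "exchange n k (\<lambda>_. 1 :: rat) B \<noteq> 0"
    using exchange_pos[of n "\<lambda>_. 1" k B] by simp
  then show "exchange n k x B \<noteq> 0"
    using specialization_nonzero[OF L(1)] specialization_exchange[OF L(1), of n x "\<lambda>_. 1" k B] L(2)
    by blast
qed

text \<open>The prescribed values are pulled back: mutating them over the rationals gives positive
  values for the old cluster, some specialization takes these, and dividing the exchange binomial by
  the old variable inside it returns the prescribed value.\<close>

lemma specializable_mutate: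
  assumes x: "specializable n x" and k: "k \<in> {1..n}" and B: "B k k = 0"
  shows "specializable n (mutate_cluster n k x B)"
  unfolding specializable_def
proof (intro allI impI)
  fix r' :: "nat \<Rightarrow> rat"
  assume "\<forall>i\<in>{1..n}. r' i > 0"
  then have pos': "\<And>i. i \<in> {1..n} \<Longrightarrow> r' i > 0"
    by blast
  define r where "r = mutate_cluster n k r' (mutate_matrix k B)"
  have r': "r' = mutate_cluster n k r B"
    using mutate_cluster_involutive[of "mutate_matrix k B" k r' n] pos'[OF k]
      exchange_pos[of n r' k "mutate_matrix k B", OF pos'] B
    unfolding r_def mutate_matrix_involutive by (simp add: mutate_matrix_def)
  have pos: "r i > 0" if "i \<in> {1..n}" for i
    using that pos' exchange_pos[of n r' k "mutate_matrix k B", OF pos']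
    by (simp add: r_def mutate_cluster_exchange)
  then obtain L where L: "specialization L" "\<And>i. i \<in> {1..n} \<Longrightarrow> (x i, r i) \<in> L"
    using x unfolding specializable_def by meson
  have "(mutate_cluster n k x B i, r' i) \<in> L" if "i \<in> {1..n}" for i
    using that L(2) specialization_divide[OF L(1) specialization_exchange[OF L] L(2)[OF k]] pos[OF k]
    by (auto simp: r' mutate_cluster_exchange)
  then show "\<exists>L. specialization L \<and> (\<forall>i\<in>{1..n}. (mutate_cluster n k x B i, r' i) \<in> L)"
    using L(1) by blast
qed

text \<open>The invariant carried along mutations in place of \<open>labeled_seed\<close>.\<close>

definition good_seed :: "nat \<Rightarrow> 'a::field seed \<Rightarrow> bool" where
  "good_seed n s \<longleftrightarrow> specializable n (fst s) \<and> skew_symmetrizable n (snd s)"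

lemma good_seed_mutate:
  assumes "good_seed n s" "k \<in> {1..n}"
  shows "good_seed n (mutate_seed n k s)" and "mutate_seed n k (mutate_seed n k s) = s"
proof -
  have s: "specializable n (fst s)" "skew_symmetrizable n (snd s)"
    using assms by (auto simp: good_seed_def)
  note B = skew_symmetrizable_diagonal[OF s(2) assms(2)]
  show "good_seed n (mutate_seed n k s)"
    using specializable_mutate[of n "fst s" k "snd s"] skew_symmetrizable_mutate[OF s(2) assms(2)] s B assms(2)
    by (simp add: good_seed_def mutate_seed_def)
  show "mutate_seed n k (mutate_seed n k s) = s"
    using mutate_cluster_involutive[of "snd s" k "fst s" n] B specializable_nonzero[OF s(1)] assms(2)
    by (simp add: mutate_seed_def mutate_matrix_involutive)
qed

lemma reachable_seeds_trans:
  assumes "u \<in> reachable_seeds n t" "t \<in> reachable_seeds n s"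
  shows "u \<in> reachable_seeds n s"
  using assms by induction (auto intro: reachable_seeds.intros)

text \<open>Each mutation is its own inverse on good seeds, so reachability is symmetric among
  them.\<close>

lemma good_seed_reachable:
  assumes "t \<in> reachable_seeds n s" "good_seed n s"
  shows "good_seed n t \<and> s \<in> reachable_seeds n t"
  using assms
proof induction
  case initial
  then show ?case
    by (auto intro: reachable_seeds.initial)
next
  case (mutate t k)
  note good = good_seed_mutate[of n t k]
  have "t \<in> reachable_seeds n (mutate_seed n k t)"
    using reachable_seeds.mutate[OF reachable_seeds.initial, of k n "mutate_seed n k t"] good mutate
    by simp
  then show ?case
    using mutate good reachable_seeds_trans by blast
qed

lemma cluster_complex_reachable:
  assumes "t \<in> reachable_seeds n s" "good_seed n s"
  shows "cluster_complex n t = cluster_complex n s"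
proof -
  have "reachable_seeds n t = reachable_seeds n s"
    using good_seed_reachable[OF assms] assms(1) reachable_seeds_trans by blast
  then show ?thesis
    by (simp add: cluster_complex_def)
qed

lemma labeled_seed_good: "labeled_seed F n s \<Longrightarrow> good_seed n s"
  by (simp add: labeled_seed_def good_seed_def free_generating_set_def
      algebraically_independent_specializable)


section \<open>Friezes\<close>

text \<open>The polygon has vertices \<open>0\<close>, ..., \<open>N - 1\<close> in cyclic order,
  and a chord is stored with its smaller end point first. The side that closes up the polygon is
  therefore \<open>(0, N - 1)\<close> and has to be excluded separately.\<close>

definition diagonals :: "nat \<Rightarrow> (nat \<times> nat) set" where
  "diagonals N = {(i, j). Suc i < j \<and> j < N \<and> (i, j) \<noteq> (0, N - 1)}"

text \<open>Conway-Coxeter friezes with entries in a field, written as functions on chords; the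
  relations are Ptolemy's for inscribed quadrilaterals.\<close>

definition frieze :: "nat \<Rightarrow> (nat \<times> nat \<Rightarrow> 'a::field) \<Rightarrow> bool" where
  "frieze N X \<longleftrightarrow>
     (\<forall>i. Suc i < N \<longrightarrow> X (i, Suc i) = 1) \<and> X (0, N - 1) = 1 \<and>
     (\<forall>i j k l. i < j \<and> j < k \<and> k < l \<and> l < N \<longrightarrow>
        X (i, k) * X (j, l) = X (i, j) * X (k, l) + X (i, l) * X (j, k))"

text \<open>The Ptolemy relation for \<open>0 < i < j < k\<close>, divided by
  \<open>a i * a j * a k\<close>, says that \<open>X (i, k) / (a i * a k)\<close> is additive when
  intervals are joined. A side from \<open>t\<close> to \<open>Suc t\<close> has value 1 and
  contributes \<open>1 / (a t * a (Suc t))\<close>, whence the sum.\<close>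

definition fan_frieze :: "(nat \<Rightarrow> 'a::field) \<Rightarrow> nat \<times> nat \<Rightarrow> 'a" where
  "fan_frieze a = (\<lambda>(i, j). if i = 0 then a j
     else a i * a j * (\<Sum>t=i..<j. 1 / (a t * a (Suc t))))"

text \<open>In terms of the partial sums \<open>S\<close>, the relation away from \<open>0\<close>
  is the identity \<open>(S k - S i) * (S l - S j) = (S j - S i) * (S l - S k) + (S l - S i) * (S k
  - S j)\<close>; with \<open>i = 0\<close> it is telescoping.\<close>

lemma frieze_fan_frieze:
  assumes "N \<ge> 3" "a 1 = 1" "a (N - 1) = 1" "\<And>j. 1 \<le> j \<Longrightarrow> j < N \<Longrightarrow> a j \<noteq> 0"
  shows "frieze N (fan_frieze a)"
proof -
  define S where "S j = (\<Sum>t=1..<j. 1 / (a t * a (Suc t)))" for j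
  have X: "fan_frieze a (i, j) = (if i = 0 then a j else a i * a j * (S j - S i))" if "i < j" for i j
    using that sum.atLeastLessThan_concat[of 1 i j "\<lambda>t. 1 / (a t * a (Suc t))"]
    by (cases "i = 0") (auto simp: fan_frieze_def S_def eq_diff_eq add.commute)
  show ?thesis
    unfolding frieze_def
  proof (intro conjI allI impI; (elim conjE)?)
    fix i
    assume "Suc i < N"
    then show "fan_frieze a (i, Suc i) = 1"
      using assms(2) assms(4)[of i] assms(4)[of "Suc i"] by (auto simp: fan_frieze_def)
  next
    show "fan_frieze a (0, N - 1) = 1"
      using assms by (simp add: fan_frieze_def)
  next
    fix i j k l
    assume "i < j" "j < k" "k < l" "l < N"
    then show "fan_frieze a (i, k) * fan_frieze a (j, l) =
        fan_frieze a (i, j) * fan_frieze a (k, l) + fan_frieze a (i, l) * fan_frieze a (j, k)"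
      by (auto simp: X algebra_simps)
  qed
qed

text \<open>The frieze all of whose diagonals at the vertex \<open>p\<close> have value 1.\<close>

definition unit_fan_frieze :: "nat \<Rightarrow> nat \<Rightarrow> nat \<times> nat \<Rightarrow> rat" where
  "unit_fan_frieze N p = (\<lambda>(i, j). if i = p \<or> j = p then 1
     else if i < p \<and> p < j then of_nat N + of_nat i - of_nat j else of_nat j - of_nat i)"

text \<open>For a chord not at \<open>p\<close>, the value is the number of sides on the boundary
  path that avoids \<open>p\<close>. Numbering the vertices from \<open>p\<close> onwards makes it a
  difference of two positions, so the relations are the identity for differences of four numbers, or
  additivity when \<open>p\<close> is one of the four vertices.\<close>

lemma frieze_unit_fan_frieze:
  assumes "N \<ge> 3" "p < N"
  shows "frieze N (unit_fan_frieze N p)"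
  unfolding frieze_def
proof (intro conjI allI impI; (elim conjE)?)
  fix i j k l
  assume *: "i < j" "j < k" "k < l" "l < N"
  let ?X = "unit_fan_frieze N p"
  consider "p < i" | "p = i" | "i < p" "p < j" | "p = j" | "j < p" "p < k" | "p = k"
    | "k < p" "p < l" | "p = l" | "l < p"
    by linarith
  then show "?X (i, k) * ?X (j, l) = ?X (i, j) * ?X (k, l) + ?X (i, l) * ?X (j, k)"
    using * by cases (auto simp: unit_fan_frieze_def algebra_simps)
qed (use assms in \<open>auto simp: unit_fan_frieze_def of_nat_diff\<close>)

lemma unit_fan_frieze_pos:
  assumes "i < j" "j < N"
  shows "unit_fan_frieze N p (i, j) > 0"
proof -
  have "(of_nat j :: rat) < of_nat N" "(of_nat i :: rat) < of_nat j" "(0 :: rat) \<le> of_nat i"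
    using assms by auto
  then show ?thesis
    unfolding unit_fan_frieze_def by simp
qed

text \<open>A diagonal cuts off at least two sides of the polygon in either direction, and the value
  counts the sides in one of them.\<close>

lemma unit_fan_frieze_ge_2:
  assumes "(i, j) \<in> diagonals N" "i \<noteq> p" "j \<noteq> p"
  shows "unit_fan_frieze N p (i, j) \<ge> 2"
proof -
  have "i + 2 \<le> j" "j + 2 \<le> N + i"
    using assms(1) by (auto simp: diagonals_def)
  then have "(of_nat (i + 2) :: rat) \<le> of_nat j" "(of_nat (j + 2) :: rat) \<le> of_nat (N + i)"
    by (auto simp only: of_nat_le_iff)
  then show ?thesis
    using assms unfolding unit_fan_frieze_def by simp
qed

text \<open>The relation for \<open>0\<close>, \<open>i\<close>, \<open>j\<close>,
  \<open>Suc j\<close>, solved for the longest chord not at \<open>0\<close>. It involves no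
  subtraction, so it can be followed inside a specialization.\<close>

lemma frieze_recursion:
  assumes "frieze N X" "1 \<le> i" "i < j" "Suc j < N" "X (0, j) \<noteq> 0"
  shows "X (i, Suc j) = (X (0, i) + X (0, Suc j) * X (i, j)) / X (0, j)"
proof -
  have "X (0, j) * X (i, Suc j) = X (0, i) * X (j, Suc j) + X (0, Suc j) * X (i, j)"
    using assms(1-4) unfolding frieze_def by simp
  moreover have "X (j, Suc j) = 1"
    using assms unfolding frieze_def by simp
  ultimately show ?thesis
    using assms(5) by (simp add: field_simps)
qed

text \<open>The recursion computes both friezes in parallel from their fans at \<open>0\<close>;
  only fan entries occur as divisors.\<close>

lemma frieze_specialization:
  assumes L: "specialization L" and X: "frieze N X" and Y: "frieze N Y"
    and fan: "\<And>j. 1 \<le> j \<Longrightarrow> j < N \<Longrightarrow> (X (0, j), Y (0, j)) \<in> L \<and> Y (0, j) \<noteq> 0"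
    and ij: "i < j" "j < N"
  shows "(X (i, j), Y (i, j)) \<in> L"
proof (cases "i = 0")
  case True
  then show ?thesis using fan ij by simp
next
  case False
  then have i: "1 \<le> i"
    by simp
  show ?thesis
    using ij
  proof (induction j)
    case 0
    then show ?case by simp
  next
    case (Suc j)
    show ?case
    proof (cases "i = j")
      case True
      then show ?thesis
        using X Y Suc.prems specialization_one[OF L] unfolding frieze_def by simp
    next
      case False
      then have j: "i < j" "1 \<le> j" "j < N" "Suc j < N" "i < N"
        using Suc.prems i by auto
      note nonzero = specialization_nonzero[OF L conjunct1[OF fan] conjunct2[OF fan]]
      have "((X (0, i) + X (0, Suc j) * X (i, j)) / X (0, j),
          (Y (0, i) + Y (0, Suc j) * Y (i, j)) / Y (0, j)) \<in> L"
        using fan[of i] fan[of j] fan[of "Suc j"] Suc.IH i j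
        by (intro specialization_divide[OF L] specialization_add[OF L] specialization_mult[OF L]) auto
      then show ?thesis
        using frieze_recursion[OF X i j(1,4) nonzero] frieze_recursion[OF Y i j(1,4)] fan[of j] j
        by simp
    qed
  qed
qed

text \<open>Distinct diagonals are told apart by specializing to the unit fan at an end point of one
  of them that is not an end point of the other.\<close>

lemma specializable_frieze:
  fixes x :: "nat \<Rightarrow> 'a::field"
  assumes x: "specializable n x" and p: "bij_betw p {1..n} {1..n}"
  obtains X where "frieze (n + 3) X" "\<And>j. j \<in> {1..n} \<Longrightarrow> X (0, Suc j) = x (p j)"
    "\<And>d. d \<in> diagonals (n + 3) \<Longrightarrow> X d \<noteq> 0" "inj_on X (diagonals (n + 3))"
proof -
  let ?N = "n + 3"
  \<comment> \<open>The diagonals \<open>(0, 2)\<close>, ..., \<open>(0, n + 1)\<close> carry the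
    variables in the order of \<open>p\<close>. The default 1 gives the sides \<open>(0, 1)\<close>
    and \<open>(0, n + 2)\<close> their value and keeps all entries nonzero.\<close>
  define a where "a j = (if 2 \<le> j \<and> j \<le> n + 1 then x (p (j - 1)) else 1)" for j
  define X where "X = fan_frieze a"
  have p_in: "p j \<in> {1..n}" if "j \<in> {1..n}" for j
    using p that bij_betwE by blast
  have "a j \<noteq> 0" for j
    using specializable_nonzero(1)[OF x p_in[of "j - 1"]] by (cases j) (auto simp: a_def)
  then have X: "frieze ?N X"
    unfolding X_def by (intro frieze_fan_frieze) (auto simp: a_def)
  have "\<exists>L. specialization L \<and> (\<forall>i j. i < j \<and> j < ?N \<longrightarrow>
      (X (i, j), unit_fan_frieze ?N v (i, j)) \<in> L)" if v: "v < ?N" for v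
  proof -
    \<comment> \<open>Each variable is prescribed the value of the unit fan frieze at
      \<open>v\<close> on the diagonal that carries this variable.\<close>
    define r where "r i = unit_fan_frieze ?N v (0, Suc (inv_into {1..n} p i))" for i
    have inv_in: "inv_into {1..n} p i \<in> {1..n}" if "i \<in> {1..n}" for i
      using p that by (metis bij_betw_imp_surj_on inv_into_into)
    have "r i > 0" if "i \<in> {1..n}" for i
      using inv_in[OF that] unfolding r_def by (intro unit_fan_frieze_pos) auto
    then obtain L where L: "specialization L" "\<And>i. i \<in> {1..n} \<Longrightarrow> (x i, r i) \<in> L"
      using x unfolding specializable_def by meson
    have Y: "frieze ?N (unit_fan_frieze ?N v)"
      using frieze_unit_fan_frieze[of ?N v] v by simp
    have "(X (0, j), unit_fan_frieze ?N v (0, j)) \<in> L" if j: "1 \<le> j" "j < ?N" for j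
    proof (cases "2 \<le> j \<and> j \<le> n + 1")
      case True
      then have "j - 1 \<in> {1..n}"
        by auto
      moreover from this have "inv_into {1..n} p (p (j - 1)) = j - 1"
        using p by (metis bij_betw_imp_inj_on inv_into_f_f)
      ultimately show ?thesis
        using L(2)[OF p_in[of "j - 1"]] True by (simp add: X_def fan_frieze_def a_def r_def)
    next
      case False
      then have "j = 1 \<or> j = ?N - 1"
        using j by auto
      then have "unit_fan_frieze ?N v (0, j) = 1"
        using Y unfolding frieze_def by auto
      moreover have "X (0, j) = 1"
        using False by (auto simp: X_def fan_frieze_def a_def)
      ultimately show ?thesis
        using specialization_one[OF L(1)] by simp
    qed
    then have "(X (i, j), unit_fan_frieze ?N v (i, j)) \<in> L" if "i < j" "j < ?N" for i j
      using frieze_specialization[OF L(1) X Y _ that] unit_fan_frieze_pos[of 0 _ ?N v]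
      by (metis less_le_trans less_numeral_extra(1) order_less_irrefl)
    then show ?thesis
      using L(1) by blast
  qed
  then obtain L where L: "\<And>v. v < ?N \<Longrightarrow> specialization (L v)"
    and XL: "\<And>v i j. v < ?N \<Longrightarrow> i < j \<Longrightarrow> j < ?N \<Longrightarrow>
      (X (i, j), unit_fan_frieze ?N v (i, j)) \<in> L v"
    by metis
  have "X d \<noteq> 0" if "d \<in> diagonals ?N" for d
  proof -
    obtain i j where "d = (i, j)" "i < j" "j < ?N"
      using \<open>d \<in> diagonals ?N\<close> by (auto simp: diagonals_def)
    then show ?thesis
      using specialization_nonzero[OF L[of 0] XL[of 0 i j]] unit_fan_frieze_pos[of i j ?N 0] by auto
  qed
  moreover have "inj_on X (diagonals ?N)"
  proof -
    have separate: "X (i, j) \<noteq> X (k, l)"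
      if "(i, j) \<in> diagonals ?N" "(k, l) \<in> diagonals ?N" "v \<in> {i, j}" "v \<notin> {k, l}" for i j k l v
    proof
      assume eq: "X (i, j) = X (k, l)"
      have "i < j" "j < ?N" "k < l" "l < ?N" "v < ?N"
        using that by (auto simp: diagonals_def)
      then have "unit_fan_frieze ?N v (i, j) = unit_fan_frieze ?N v (k, l)"
        using XL[of v i j] XL[of v k l] specialization_unique[OF L[of v]] eq by simp
      moreover have "unit_fan_frieze ?N v (i, j) = 1"
        using that(3) by (auto simp: unit_fan_frieze_def)
      ultimately show False
        using unit_fan_frieze_ge_2[OF that(2), of v] that(4) by auto
    qed
    show ?thesis
    proof (rule inj_onI, clarify)
      fix i j k l
      assume *: "(i, j) \<in> diagonals ?N" "(k, l) \<in> diagonals ?N" "X (i, j) = X (k, l)"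
      then have "{i, j} \<subseteq> {k, l}" "{k, l} \<subseteq> {i, j}"
        using separate[OF *(1,2)] separate[OF *(2,1)] *(3) by (metis subsetI)+
      moreover have "i < j" "k < l"
        using * by (auto simp: diagonals_def)
      ultimately show "i = k \<and> j = l"
        by auto
    qed
  qed
  moreover have "X (0, Suc j) = x (p j)" if "j \<in> {1..n}" for j
    using that by (simp add: X_def fan_frieze_def a_def)
  ultimately show ?thesis
    using that X by blast
qed


section \<open>Triangulations of a polygon\<close>

fun crosses :: "nat \<times> nat \<Rightarrow> nat \<times> nat \<Rightarrow> bool" where
  "crosses (a, b) (c, d) \<longleftrightarrow> a < c \<and> c < b \<and> b < d \<or> c < a \<and> a < d \<and> d < b"

definition noncrossing :: "(nat \<times> nat) set \<Rightarrow> bool" where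
  "noncrossing S \<longleftrightarrow> (\<forall>d\<in>S. \<forall>e\<in>S. \<not> crosses d e)"

definition polygon_complex :: "nat \<Rightarrow> (nat \<times> nat) set set" where
  "polygon_complex N = {S. S \<subseteq> diagonals N \<and> noncrossing S}"

text \<open>Maximality among noncrossing sets replaces a list of triangles; the triangles on either
  side of an edge are recovered from it.\<close>

definition triangulation :: "nat \<Rightarrow> (nat \<times> nat) set \<Rightarrow> bool" where
  "triangulation N T \<longleftrightarrow> T \<in> polygon_complex N \<and>
     (\<forall>d\<in>diagonals N. (\<forall>e\<in>T. \<not> crosses d e) \<longrightarrow> d \<in> T)"

definition sides :: "nat \<Rightarrow> (nat \<times> nat) set" where
  "sides N = insert (0, N - 1) {(i, Suc i) |i. Suc i < N}"

lemma crosses_sym: "crosses d e \<longleftrightarrow> crosses e d"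
  by (cases d; cases e) auto

lemma not_crosses_self: "\<not> crosses d d"
  by (cases d) auto

lemma noncrossingD:
  "noncrossing E \<Longrightarrow> (a, b) \<in> E \<Longrightarrow> (c, d) \<in> E \<Longrightarrow> a < c \<Longrightarrow> c < b \<Longrightarrow> b < d \<Longrightarrow> False"
  unfolding noncrossing_def by force

lemma finite_diagonals: "finite (diagonals N)"
  by (rule finite_subset[of _ "{..N} \<times> {..N}"]) (auto simp: diagonals_def)

lemma triangulation_extends:
  assumes "S \<in> polygon_complex N"
  obtains T where "triangulation N T" "S \<subseteq> T"
proof -
  have fin: "finite (polygon_complex N)"
    by (rule finite_subset[of _ "Pow (diagonals N)"]) (auto simp: polygon_complex_def finite_diagonals)
  obtain T where T: "T \<in> polygon_complex N" "S \<subseteq> T"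
    and max: "\<And>U. U \<in> polygon_complex N \<Longrightarrow> T \<subseteq> U \<Longrightarrow> U = T"
    using finite_has_maximal2[OF fin assms] by blast
  have "d \<in> T" if "d \<in> diagonals N" "\<forall>e\<in>T. \<not> crosses d e" for d
  proof -
    have "insert d T \<in> polygon_complex N"
      using T(1) that not_crosses_self[of d] crosses_sym[of _ d]
      unfolding polygon_complex_def noncrossing_def by blast
    then show ?thesis
      using max by blast
  qed
  then show ?thesis
    using that T unfolding triangulation_def by blast
qed

lemma sides_not_crossed:
  assumes "(a, b) \<in> sides N" "i < j" "j < N"
  shows "\<not> crosses (i, j) (a, b)"
  using assms unfolding sides_def by auto

lemma diagonal_or_side: "i < j \<Longrightarrow> j < N \<Longrightarrow> (i, j) \<in> diagonals N \<or> (i, j) \<in> sides N"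
  unfolding diagonals_def sides_def by auto

text \<open>Sides cross no chord, so adjoining them keeps the set noncrossing and lets maximality be
  applied to all chords at once.\<close>

lemma triangulation_edges:
  assumes T: "triangulation N T" and N: "N \<ge> 3"
  defines "E \<equiv> T \<union> sides N"
  shows triangulation_edge_bounds: "(i, j) \<in> E \<Longrightarrow> i < j \<and> j < N"
    and triangulation_noncrossing: "noncrossing E"
    and triangulation_maximal:
      "i < j \<Longrightarrow> j < N \<Longrightarrow> (\<And>e. e \<in> E \<Longrightarrow> \<not> crosses (i, j) e) \<Longrightarrow> (i, j) \<in> E"
proof -
  show bounds: "i < j \<and> j < N" if "(i, j) \<in> E" for i j
    using that T N
    by (auto simp: E_def triangulation_def polygon_complex_def diagonals_def sides_def)
  show "noncrossing E"
    unfolding noncrossing_def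
  proof (intro ballI)
    fix d e
    assume de: "d \<in> E" "e \<in> E"
    then consider "d \<in> T" "e \<in> T" | "d \<in> sides N" | "e \<in> sides N"
      by (auto simp: E_def)
    then show "\<not> crosses d e"
    proof cases
      case 1
      then show ?thesis
        using T by (auto simp: triangulation_def polygon_complex_def noncrossing_def)
    next
      case 2
      then show ?thesis
        using bounds de sides_not_crossed crosses_sym by (metis surj_pair)
    next
      case 3
      then show ?thesis
        using bounds de sides_not_crossed by (metis surj_pair)
    qed
  qed
  show "(i, j) \<in> E" if "i < j" "j < N" "\<And>e. e \<in> E \<Longrightarrow> \<not> crosses (i, j) e" for i j
    using diagonal_or_side[OF that(1,2)] that(3) T unfolding E_def triangulation_def by blast
qed

lemma side_in_edges: "Suc i < N \<Longrightarrow> (i, Suc i) \<in> T \<union> sides N" "(0, N - 1) \<in> T \<union> sides N"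
  by (auto simp: sides_def)

section \<open>Triangles, quadrilaterals and flips\<close>

text \<open>The apex is the largest \<open>b < c\<close> joined to \<open>a\<close>. An edge
  crossing \<open>(b, c)\<close> would cross \<open>(a, c)\<close> or \<open>(a, b)\<close>, or
  would start at \<open>a\<close> and contradict the choice of \<open>b\<close>; by maximality
  \<open>(b, c)\<close> is then an edge.\<close>

lemma triangle_below_edge:
  assumes T: "triangulation N T" and N: "N \<ge> 3"
    and ac: "(a, c) \<in> T \<union> sides N" "Suc a < c"
  obtains b where "a < b" "b < c" "(a, b) \<in> T \<union> sides N" "(b, c) \<in> T \<union> sides N"
proof -
  let ?E = "T \<union> sides N"
  note bounds = triangulation_edge_bounds[OF T N] and nc = triangulation_noncrossing[OF T N]
  define b where "b = Max {b. b < c \<and> (a, b) \<in> ?E}"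
  have ne: "Suc a \<in> {b. b < c \<and> (a, b) \<in> ?E}"
    using side_in_edges(1)[of a N T] bounds[OF ac(1)] ac(2) by auto
  have fin: "finite {b. b < c \<and> (a, b) \<in> ?E}"
    by simp
  have b: "b < c" "(a, b) \<in> ?E"
    using Max_in[OF fin] ne unfolding b_def by blast+
  have max: "b' \<le> b" if "b' < c" "(a, b') \<in> ?E" for b'
    using Max_ge[OF fin] that unfolding b_def by blast
  have "(b, c) \<in> ?E"
  proof (rule triangulation_maximal[OF T N b(1)])
    show "c < N"
      using bounds ac(1) by blast
  next
    fix e
    assume e: "e \<in> ?E"
    show "\<not> crosses (b, c) e"
    proof
      assume cr: "crosses (b, c) e"
      obtain u v where uv: "e = (u, v)"
        by force
      have "a < b" "u < v" "a < c"
        using bounds b(2) e ac(1) unfolding uv by blast+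
      from cr consider "b < u" "u < c" "c < v" | "u < b" "b < v" "v < c"
        unfolding uv by auto
      then show False
      proof cases
        case 1
        then show ?thesis
          using noncrossingD[OF nc ac(1), of u v] e uv \<open>a < b\<close> by auto
      next
        case 2
        consider "u < a" | "u = a" | "a < u"
          by linarith
        then show ?thesis
        proof cases
          case 1
          then show ?thesis
            using noncrossingD[OF nc _ ac(1), of u v] 2 e uv \<open>a < b\<close> by auto
        next
          case 3
          then show ?thesis
            using noncrossingD[OF nc b(2), of u v] 2 e uv by auto
        qed (use max[of v] 2 e uv in auto)
      qed
    qed
  qed
  then show ?thesis
    using that b bounds[OF b(2)] by blast
qed

text \<open>Among the other edges spanning \<open>(a, c)\<close>, a shortest one
  \<open>(u, v)\<close> is taken; \<open>(0, N - 1)\<close> shows that there are any. The apex of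
  the triangle below it cannot lie strictly between \<open>a\<close> and \<open>c\<close> without
  causing a crossing, so one of the two lower edges of this triangle spans \<open>(a, c)\<close>
  and, being shorter, equals it.\<close>

lemma triangle_above_edge:
  assumes T: "triangulation N T" and N: "N \<ge> 3"
    and ac: "(a, c) \<in> T \<union> sides N" "(a, c) \<noteq> (0, N - 1)"
  shows "(\<exists>d>c. (a, d) \<in> T \<union> sides N \<and> (c, d) \<in> T \<union> sides N) \<or>
    (\<exists>d<a. (d, a) \<in> T \<union> sides N \<and> (d, c) \<in> T \<union> sides N)"
proof -
  let ?E = "T \<union> sides N"
  note bounds = triangulation_edge_bounds[OF T N] and nc = triangulation_noncrossing[OF T N]
  define above where "above l \<longleftrightarrow>
    (\<exists>u v. l = v - u \<and> (u, v) \<in> ?E \<and> u \<le> a \<and> c \<le> v \<and> (u, v) \<noteq> (a, c))" for l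
  have "above (N - 1 - 0)"
    unfolding above_def using side_in_edges(2) ac bounds[OF ac(1)]
    by (intro exI[of _ 0] exI[of _ "N - 1"]) auto
  then have "above (LEAST l. above l)"
    by (rule LeastI)
  then obtain u v where uv: "(LEAST l. above l) = v - u" "(u, v) \<in> ?E" "u \<le> a" "c \<le> v" "(u, v) \<noteq> (a, c)"
    unfolding above_def by blast
  have min: "v - u \<le> v' - u'" if "(u', v') \<in> ?E" "u' \<le> a" "c \<le> v'" "(u', v') \<noteq> (a, c)" for u' v'
    unfolding uv(1)[symmetric] by (rule Least_le) (use that in \<open>auto simp: above_def\<close>)
  have "a < c"
    using bounds ac by blast
  then have "Suc u < v"
    using uv by auto
  then obtain b where b: "u < b" "b < v" "(u, b) \<in> ?E" "(b, v) \<in> ?E"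
    using triangle_below_edge[OF T N uv(2)] by blast
  have "b \<le> a \<or> c \<le> b"
  proof (rule ccontr)
    assume *: "\<not> ?thesis"
    consider "u < a" | "u = a" "c < v"
      using uv by force
    then show False
    proof cases
      case 1
      then show ?thesis
        using noncrossingD[OF nc b(3) ac(1)] * by auto
    next
      case 2
      then show ?thesis
        using noncrossingD[OF nc ac(1) b(4)] * by auto
    qed
  qed
  then show ?thesis
  proof
    assume "b \<le> a"
    then have "(b, v) = (a, c)"
      using min[OF b(4)] uv(4) b(1,2) by (cases "(b, v) = (a, c)") auto
    then show ?thesis
      using b uv by auto
  next
    assume "c \<le> b"
    then have "(u, b) = (a, c)"
      using min[OF b(3)] uv(3) b(1,2) by (cases "(u, b) = (a, c)") auto
    then show ?thesis
      using b uv by auto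
  qed
qed

definition quadrilateral :: "(nat \<times> nat) set \<Rightarrow> nat \<Rightarrow> nat \<Rightarrow> nat \<Rightarrow> nat \<Rightarrow> bool" where
  "quadrilateral E p q r s \<longleftrightarrow> p < q \<and> q < r \<and> r < s \<and>
     (p, q) \<in> E \<and> (q, r) \<in> E \<and> (r, s) \<in> E \<and> (p, s) \<in> E"

text \<open>The triangles on both sides are glued together. The diagonal becomes
  \<open>(p, r)\<close> or \<open>(q, s)\<close> according to whether the outer apex is numbered
  above or below its end points.\<close>

lemma diagonal_of_quadrilateral:
  assumes T: "triangulation N T" and N: "N \<ge> 3" and d: "d \<in> T"
  obtains p q r s where "quadrilateral (T \<union> sides N) p q r s" "d = (p, r) \<or> d = (q, s)"
proof -
  obtain a c where ac: "d = (a, c)" "(a, c) \<in> T \<union> sides N" "Suc a < c" "(a, c) \<noteq> (0, N - 1)"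
    using T d by (cases d) (auto simp: triangulation_def polygon_complex_def diagonals_def)
  obtain b where b: "a < b" "b < c" "(a, b) \<in> T \<union> sides N" "(b, c) \<in> T \<union> sides N"
    using triangle_below_edge[OF T N ac(2,3)] .
  from triangle_above_edge[OF T N ac(2,4)] show ?thesis
  proof (elim disjE exE conjE)
    fix e
    assume "c < e" "(a, e) \<in> T \<union> sides N" "(c, e) \<in> T \<union> sides N"
    then show ?thesis
      using that[of a b c e] b ac(1) by (auto simp: quadrilateral_def)
  next
    fix e
    assume "e < a" "(e, a) \<in> T \<union> sides N" "(e, c) \<in> T \<union> sides N"
    then show ?thesis
      using that[of e a b c] b ac(1) by (auto simp: quadrilateral_def)
  qed
qed

definition flip :: "(nat \<times> nat) set \<Rightarrow> nat \<times> nat \<Rightarrow> nat \<times> nat \<Rightarrow> bool" where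
  "flip E d d' \<longleftrightarrow> (\<exists>p q r s. quadrilateral E p q r s \<and>
     (d = (p, r) \<and> d' = (q, s) \<or> d = (q, s) \<and> d' = (p, r)))"

text \<open>A chord that meets the interior of the quadrilateral without crossing its sides can only
  enter and leave through vertices.\<close>

lemma crosses_quadrilateral_diagonal:
  assumes "p < q" "q < r" "r < s"
    and "\<not> crosses e (p, q)" "\<not> crosses e (q, r)" "\<not> crosses e (r, s)" "\<not> crosses e (p, s)"
  shows "crosses e (q, s) \<Longrightarrow> e = (p, r)" and "crosses e (p, r) \<Longrightarrow> e = (q, s)"
  using assms by (cases e; simp; linarith)+

lemma flip_crosses:
  assumes "flip E d d'"
  shows "crosses d d'"
    and "(\<And>f. f \<in> E \<Longrightarrow> f \<noteq> d \<Longrightarrow> \<not> crosses e f) \<Longrightarrow> crosses e d \<Longrightarrow> e = d'"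
    and "(\<And>f. f \<in> E \<Longrightarrow> f \<noteq> d \<Longrightarrow> \<not> crosses e f) \<Longrightarrow> crosses e d' \<Longrightarrow> e = d"
proof -
  obtain p q r s where *: "p < q" "q < r" "r < s" "(p, q) \<in> E" "(q, r) \<in> E" "(r, s) \<in> E" "(p, s) \<in> E"
    and d: "d = (p, r) \<and> d' = (q, s) \<or> d = (q, s) \<and> d' = (p, r)"
    using assms unfolding flip_def quadrilateral_def by blast
  show "crosses d d'"
    using d * by auto
  assume e: "\<And>f. f \<in> E \<Longrightarrow> f \<noteq> d \<Longrightarrow> \<not> crosses e f"
  have "\<not> crosses e (p, q)" "\<not> crosses e (q, r)" "\<not> crosses e (r, s)" "\<not> crosses e (p, s)"
    by (rule e; use d * in auto)+
  then show "crosses e d \<Longrightarrow> e = d'" "crosses e d' \<Longrightarrow> e = d"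
    using crosses_quadrilateral_diagonal[OF *(1-3), of e] d by auto
qed

text \<open>For maximality, let a chord cross no edge of the new set. If it crosses
  \<open>d\<close>, it is the other diagonal \<open>d'\<close>; if not, it belongs to
  \<open>T\<close>, and it is not \<open>d\<close>, since \<open>d\<close> crosses
  \<open>d'\<close>.\<close>

lemma flip_triangulation:
  assumes T: "triangulation N T" and N: "N \<ge> 3" and d: "d \<in> T" and fl: "flip (T \<union> sides N) d d'"
  shows "triangulation N (insert d' (T - {d}))" (is "triangulation N ?T'")
    and "d' \<notin> T \<union> sides N" and "d' \<in> diagonals N" and "d \<notin> sides N"
    and "flip (insert d' (T - {d}) \<union> sides N) d' d"
proof -
  let ?E = "T \<union> sides N"
  note bounds = triangulation_edge_bounds[OF T N] and nc = triangulation_noncrossing[OF T N]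
  show d'_notin: "d' \<notin> ?E"
    using flip_crosses(1)[OF fl] nc d unfolding noncrossing_def by blast
  obtain p q r s where *: "p < q" "q < r" "r < s" "(p, q) \<in> ?E" "(q, r) \<in> ?E" "(r, s) \<in> ?E" "(p, s) \<in> ?E"
    and dd': "d = (p, r) \<and> d' = (q, s) \<or> d = (q, s) \<and> d' = (p, r)"
    using fl unfolding flip_def quadrilateral_def by blast
  have "s < N"
    using bounds * by blast
  then show d': "d' \<in> diagonals N"
    using * dd' by (auto simp: diagonals_def)
  show d_side: "d \<notin> sides N"
    using T d by (auto simp: triangulation_def polygon_complex_def diagonals_def sides_def)
  have T_nc: "\<not> crosses e f" if "e \<in> ?E" "f \<in> ?E" for e f
    using that nc unfolding noncrossing_def by blast
  have new: "\<not> crosses e d'" if "e \<in> T" "e \<noteq> d" for e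
    using flip_crosses(3)[OF fl, of e] T_nc that by blast
  have new': "\<not> crosses d' e" if "e \<in> T" "e \<noteq> d" for e
    using new[OF that] crosses_sym by metis
  show "triangulation N ?T'"
    unfolding triangulation_def polygon_complex_def noncrossing_def
  proof (intro conjI ballI impI CollectI)
    show "?T' \<subseteq> diagonals N"
      using T d' by (auto simp: triangulation_def polygon_complex_def)
  next
    fix e f
    assume "e \<in> ?T'" "f \<in> ?T'"
    then show "\<not> crosses e f"
      using T_nc new new' not_crosses_self by blast
  next
    fix e
    assume e: "e \<in> diagonals N" "\<forall>f\<in>?T'. \<not> crosses e f"
    have "\<not> crosses e f" if "f \<in> ?E" "f \<noteq> d" for f
    proof (cases "f \<in> T")
      case False
      then have "f \<in> sides N"
        using that by blast
      moreover have "fst e < snd e" "snd e < N"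
        using e(1) by (auto simp: diagonals_def)
      ultimately show ?thesis
        using sides_not_crossed[of "fst f" "snd f" N "fst e" "snd e"] by simp
    qed (use e that in blast)
    then have "crosses e d \<Longrightarrow> e = d'"
      using flip_crosses(2)[OF fl] by blast
    moreover have "e \<in> ?T'" if "\<not> crosses e d"
    proof -
      have "e \<in> T"
        using T e that unfolding triangulation_def by blast
      moreover have "e \<noteq> d"
        using flip_crosses(1)[OF fl] e(2) by blast
      ultimately show ?thesis
        by blast
    qed
    ultimately show "e \<in> ?T'"
      by blast
  qed
  have "(p, q) \<noteq> d" "(q, r) \<noteq> d" "(r, s) \<noteq> d" "(p, s) \<noteq> d"
    using * dd' by auto
  then have "quadrilateral (?T' \<union> sides N) p q r s"
    using * unfolding quadrilateral_def by auto
  then show "flip (?T' \<union> sides N) d' d"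
    using dd' unfolding flip_def by blast
qed


section \<open>Flips and the quiver of a triangulation\<close>

definition fan :: "nat \<Rightarrow> (nat \<times> nat) set" where
  "fan N = {(0, j) |j. 2 \<le> j \<and> Suc j < N}"

lemma triangulation_fan: "triangulation N (fan N)"
proof -
  have "d \<in> fan N" if d: "d \<in> diagonals N" "\<forall>e\<in>fan N. \<not> crosses d e" for d
  proof -
    obtain i j where ij: "d = (i, j)" "Suc i < j" "j < N" "(i, j) \<noteq> (0, N - 1)"
      using d(1) by (auto simp: diagonals_def)
    have "i = 0"
    proof (rule ccontr)
      assume "i \<noteq> 0"
      \<comment> \<open>The chord from \<open>0\<close> to \<open>Suc i\<close> separates
        \<open>i\<close> from \<open>j\<close>.\<close>
      then have "(0, Suc i) \<in> fan N" "crosses d (0, Suc i)"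
        using ij by (auto simp: fan_def)
      then show False
        using d(2) by blast
    qed
    then show ?thesis
      using ij by (auto simp: fan_def)
  qed
  then show ?thesis
    by (auto simp: triangulation_def polygon_complex_def noncrossing_def fan_def diagonals_def)
qed

text \<open>The induction is on the number of missing diagonals at the vertex 0: as long as there is one,
  some flip adds one.\<close>

lemma triangulation_flip_induct [consumes 2, case_names fan flip]:
  assumes "triangulation N T" "N \<ge> 3"
    and fan: "P (fan N)"
    and flip: "\<And>T d d'. triangulation N T \<Longrightarrow> P T \<Longrightarrow> d \<in> T \<Longrightarrow> flip (T \<union> sides N) d d' \<Longrightarrow>
      P (insert d' (T - {d}))"
  shows "P T"
  using assms(1)
proof (induction "card {j. j < N \<and> (0, j) \<notin> T \<union> sides N}" arbitrary: T rule: less_induct)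
  case less
  note T = less.prems and N = \<open>N \<ge> 3\<close>
  let ?E = "T \<union> sides N"
  note bounds = triangulation_edge_bounds[OF T N] and nc = triangulation_noncrossing[OF T N]
  show ?case
  proof (cases "\<forall>j. 1 \<le> j \<longrightarrow> j < N \<longrightarrow> (0, j) \<in> ?E")
    case True
    have "fan N \<subseteq> T"
    proof
      fix d
      assume "d \<in> fan N"
      then obtain j where "d = (0, j)" "2 \<le> j" "Suc j < N"
        by (auto simp: fan_def)
      moreover from this have "(0, j) \<in> ?E"
        using True by simp
      moreover from calculation have "(0, j) \<notin> sides N"
        unfolding sides_def by auto
      ultimately show "d \<in> T"
        by blast
    qed
    moreover have "T \<subseteq> fan N"
    proof
      fix d
      assume d: "d \<in> T"
      then obtain i j where ij: "d = (i, j)" "Suc i < j" "j < N" "(i, j) \<noteq> (0, N - 1)"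
        using T by (auto simp: triangulation_def polygon_complex_def diagonals_def)
      have "i = 0"
        using noncrossingD[OF nc, of 0 "Suc i" i j] True ij d by auto
      then show "d \<in> fan N"
        using ij by (auto simp: fan_def)
    qed
    ultimately show ?thesis
      using fan by simp
  next
    case False
    then obtain b where b: "1 \<le> b" "b < N" "(0, b) \<notin> ?E"
      by blast
    \<comment> \<open>\<open>c\<close> is the next neighbour of \<open>0\<close> beyond the missing
      \<open>b\<close>. The apex \<open>a\<close> of the triangle below \<open>(0, c)\<close> then
      lies before \<open>b\<close>, so \<open>(a, c)\<close> is a diagonal with a further triangle
      below it; with \<open>m\<close> the apex of that one, flipping \<open>(a, c)\<close> creates
      \<open>(0, m)\<close>.\<close>
    define c where "c = (LEAST c. b < c \<and> (0, c) \<in> ?E)"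
    have "b \<noteq> N - 1"
      using side_in_edges(2)[of N T] b(3) by metis
    then have "b < N - 1 \<and> (0, N - 1) \<in> ?E"
      using b side_in_edges(2)[of N T] by linarith
    then have c: "b < c" "(0, c) \<in> ?E"
      using LeastI[of "\<lambda>c. b < c \<and> (0, c) \<in> ?E"] unfolding c_def by blast+
    have c_min: "c \<le> c'" if "b < c'" "(0, c') \<in> ?E" for c'
      unfolding c_def using that by (simp add: Least_le)
    have "Suc 0 < c"
      using b c by simp
    then obtain a where a: "0 < a" "a < c" "(0, a) \<in> ?E" "(a, c) \<in> ?E"
      using triangle_below_edge[OF T N c(2)] by blast
    have "a < b"
      using c_min[of a] a b(3) by (cases a b rule: linorder_cases) auto
    then have "Suc a < c"
      using c by simp
    then obtain m where m: "a < m" "m < c" "(a, m) \<in> ?E" "(m, c) \<in> ?E"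
      using triangle_below_edge[OF T N a(4)] by blast
    have fl: "flip ?E (a, c) (0, m)"
      unfolding flip_def quadrilateral_def using a m c(2) by blast
    have ac: "(a, c) \<in> T"
      using a \<open>Suc a < c\<close> by (auto simp: sides_def)
    let ?T' = "insert (0, m) (T - {(a, c)})"
    note flipped = flip_triangulation[OF T N ac fl]
    have "m < N"
      using bounds m by blast
    have "{j. j < N \<and> (0, j) \<notin> ?T' \<union> sides N} \<subset> {j. j < N \<and> (0, j) \<notin> ?E}"
      using a(1) \<open>m < N\<close> flipped(2) by auto
    then have "card {j. j < N \<and> (0, j) \<notin> ?T' \<union> sides N} < card {j. j < N \<and> (0, j) \<notin> ?E}"
      by (intro psubset_card_mono) auto
    then have "P ?T'"
      using less.hyps flipped(1) by blast
    \<comment> \<open>The induction hypothesis concerns the triangulation closer to the fan, so the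
      rule \<open>flip\<close> is applied to the reverse flip.\<close>
    then have "P (insert (a, c) (?T' - {(0, m)}))"
      using flip[OF flipped(1) _ _ flipped(5)] by blast
    moreover have "insert (a, c) (?T' - {(0, m)}) = T"
      using ac flipped(2) by auto
    ultimately show ?thesis
      by simp
  qed
qed

text \<open>\<open>clockwise_triangle e f t\<close> lists the edges of a triangle in the rotational order in which
  the arrows of the quiver of a triangulation run.\<close>

definition clockwise_triangle :: "nat \<times> nat \<Rightarrow> nat \<times> nat \<Rightarrow> nat \<times> nat \<Rightarrow> bool" where
  "clockwise_triangle e f t \<longleftrightarrow> (\<exists>i j k. i < j \<and> j < k \<and>
     (e, f, t) \<in> {((i, j), (i, k), (j, k)), ((i, k), (j, k), (i, j)), ((j, k), (i, j), (i, k))})"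

definition arrow :: "(nat \<times> nat) set \<Rightarrow> nat \<times> nat \<Rightarrow> nat \<times> nat \<Rightarrow> bool" where
  "arrow E e f \<longleftrightarrow> (\<exists>t\<in>E. clockwise_triangle e f t)"

text \<open>The signed adjacency matrix of a triangulation. Two distinct chords span at most one
  triangle, so truth values already count the arrows.\<close>

definition signed_adjacency :: "(nat \<times> nat) set \<Rightarrow> nat \<times> nat \<Rightarrow> nat \<times> nat \<Rightarrow> int" where
  "signed_adjacency E e f = of_bool (arrow E e f) - of_bool (arrow E f e)"

lemma clockwise_triangle_rotate: "clockwise_triangle e f t \<Longrightarrow> clockwise_triangle f t e"
  unfolding clockwise_triangle_def by blast

lemma clockwise_triangle_iff:
  "clockwise_triangle (a, b) (c, d) t \<longleftrightarrow>
     c = a \<and> a < b \<and> b < d \<and> t = (b, d) \<or> d = b \<and> a < c \<and> c < b \<and> t = (a, c) \<or>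
     d = a \<and> c < a \<and> a < b \<and> t = (c, b)"
  unfolding clockwise_triangle_def by auto

text \<open>Different apexes on the same side of an edge would give crossing edges. The outer side
  takes two shapes, its apex being numbered above or below both end points, and the last claim
  excludes having both.\<close>

lemma unique_apex:
  assumes "noncrossing E"
  shows unique_apex_between: "(a, b) \<in> E \<Longrightarrow> (b, c) \<in> E \<Longrightarrow> (a, b') \<in> E \<Longrightarrow> (b', c) \<in> E \<Longrightarrow>
      a < b \<Longrightarrow> b < c \<Longrightarrow> a < b' \<Longrightarrow> b' < c \<Longrightarrow> b = b'"
    and unique_apex_above: "(a, d) \<in> E \<Longrightarrow> (c, d) \<in> E \<Longrightarrow> (a, d') \<in> E \<Longrightarrow> (c, d') \<in> E \<Longrightarrow>
      a < c \<Longrightarrow> c < d \<Longrightarrow> c < d' \<Longrightarrow> d = d'"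
    and unique_apex_below: "(d, a) \<in> E \<Longrightarrow> (d, c) \<in> E \<Longrightarrow> (d', a) \<in> E \<Longrightarrow> (d', c) \<in> E \<Longrightarrow>
      a < c \<Longrightarrow> d < a \<Longrightarrow> d' < a \<Longrightarrow> d = d'"
    and no_apex_above_below: "(a, d) \<in> E \<Longrightarrow> (d', c) \<in> E \<Longrightarrow>
      a < c \<Longrightarrow> c < d \<Longrightarrow> d' < a \<Longrightarrow> False"
proof -
  note nc = noncrossingD[OF assms]
  show "b = b'" if "(a, b) \<in> E" "(b, c) \<in> E" "(a, b') \<in> E" "(b', c) \<in> E"
      "a < b" "b < c" "a < b'" "b' < c"
    using nc[OF that(3,2)] nc[OF that(1,4)] that by (cases b b' rule: linorder_cases) auto
  show "d = d'" if "(a, d) \<in> E" "(c, d) \<in> E" "(a, d') \<in> E" "(c, d') \<in> E"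
      "a < c" "c < d" "c < d'"
    using nc[OF that(1,4)] nc[OF that(3,2)] that by (cases d d' rule: linorder_cases) auto
  show "d = d'" if "(d, a) \<in> E" "(d, c) \<in> E" "(d', a) \<in> E" "(d', c) \<in> E"
      "a < c" "d < a" "d' < a"
    using nc[OF that(1,4)] nc[OF that(3,2)] that by (cases d d' rule: linorder_cases) auto
  show False if "(a, d) \<in> E" "(d', c) \<in> E" "a < c" "c < d" "d' < a"
    using nc[OF that(2,1)] that by linarith
qed

text \<open>By uniqueness of apexes, the triangles on \<open>(p, r)\<close> have third vertex
  \<open>q\<close> or \<open>s\<close>, and each contributes one incoming and one outgoing
  arrow.\<close>

lemma arrow_first_diagonal:
  assumes nc: "noncrossing E" and quad: "quadrilateral E p q r s" and e: "e \<in> E"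
  shows "arrow E e (p, r) \<longleftrightarrow> e \<in> {(p, q), (r, s)}"
    and "arrow E (p, r) e \<longleftrightarrow> e \<in> {(q, r), (p, s)}"
proof -
  have between: "x = q" if "(p, x) \<in> E" "(x, r) \<in> E" "p < x" "x < r" for x
    using unique_apex_between[OF nc, of p x r q] quad that by (simp add: quadrilateral_def)
  have above: "x = s" if "(p, x) \<in> E" "(r, x) \<in> E" "r < x" for x
    using unique_apex_above[OF nc, of p x r s] quad that by (simp add: quadrilateral_def)
  have below: "\<not> ((x, r) \<in> E \<and> x < p)" for x
    using no_apex_above_below[OF nc, of p s x r] quad by (auto simp: quadrilateral_def)
  obtain a b where ab: "e = (a, b)"
    by force
  have 1: "arrow E (a, b) (p, r) \<longleftrightarrow> a = p \<and> p < b \<and> b < r \<and> (b, r) \<in> E \<or>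
      b = r \<and> a < p \<and> p < r \<and> (a, p) \<in> E \<or> a = r \<and> p < r \<and> r < b \<and> (p, b) \<in> E"
    unfolding arrow_def clockwise_triangle_iff by auto
  have 2: "arrow E (p, r) (a, b) \<longleftrightarrow> a = p \<and> p < r \<and> r < b \<and> (r, b) \<in> E \<or>
      b = r \<and> p < a \<and> a < r \<and> (p, a) \<in> E \<or> b = p \<and> a < p \<and> p < r \<and> (a, r) \<in> E"
    unfolding arrow_def clockwise_triangle_iff by auto
  have "p < r"
    using quad by (auto simp: quadrilateral_def)
  then show "arrow E e (p, r) \<longleftrightarrow> e \<in> {(p, q), (r, s)}"
    using between above below quad e unfolding ab 1 quadrilateral_def by blast
  show "arrow E (p, r) e \<longleftrightarrow> e \<in> {(q, r), (p, s)}"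
    using \<open>p < r\<close> between above below quad e unfolding ab 2 quadrilateral_def by blast
qed

lemma arrow_second_diagonal:
  assumes nc: "noncrossing E" and quad: "quadrilateral E p q r s" and e: "e \<in> E"
  shows "arrow E e (q, s) \<longleftrightarrow> e \<in> {(q, r), (p, s)}"
    and "arrow E (q, s) e \<longleftrightarrow> e \<in> {(p, q), (r, s)}"
proof -
  have between: "x = r" if "(q, x) \<in> E" "(x, s) \<in> E" "q < x" "x < s" for x
    using unique_apex_between[OF nc, of q x s r] quad that by (simp add: quadrilateral_def)
  have below: "x = p" if "(x, q) \<in> E" "(x, s) \<in> E" "x < q" for x
    using unique_apex_below[OF nc, of x q s p] quad that by (simp add: quadrilateral_def)
  have above: "\<not> ((q, x) \<in> E \<and> s < x)" for x
    using no_apex_above_below[OF nc, of q x p s] quad by (auto simp: quadrilateral_def)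
  obtain a b where ab: "e = (a, b)"
    by force
  have 1: "arrow E (a, b) (q, s) \<longleftrightarrow> a = q \<and> q < b \<and> b < s \<and> (b, s) \<in> E \<or>
      b = s \<and> a < q \<and> q < s \<and> (a, q) \<in> E \<or> a = s \<and> q < s \<and> s < b \<and> (q, b) \<in> E"
    unfolding arrow_def clockwise_triangle_iff by auto
  have 2: "arrow E (q, s) (a, b) \<longleftrightarrow> a = q \<and> q < s \<and> s < b \<and> (s, b) \<in> E \<or>
      b = s \<and> q < a \<and> a < s \<and> (q, a) \<in> E \<or> b = q \<and> a < q \<and> q < s \<and> (a, s) \<in> E"
    unfolding arrow_def clockwise_triangle_iff by auto
  have "q < s" "p < s"
    using quad by (auto simp: quadrilateral_def)
  then show "arrow E e (q, s) \<longleftrightarrow> e \<in> {(q, r), (p, s)}"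
    using between above below quad e unfolding ab 1 quadrilateral_def by blast
  show "arrow E (q, s) e \<longleftrightarrow> e \<in> {(p, q), (r, s)}"
    using \<open>q < s\<close> between above below quad e unfolding ab 2 quadrilateral_def by blast
qed

lemma signed_adjacency_skew: "signed_adjacency E f e = - signed_adjacency E e f"
  by (simp add: signed_adjacency_def)

text \<open>The two diagonals see the four sides with opposite signs, which is the negation of row
  and column \<open>k\<close> in matrix mutation.\<close>

lemma signed_adjacency_diagonals:
  assumes "noncrossing E" "quadrilateral E p q r s" "e \<in> E"
  shows "signed_adjacency E e (p, r) = of_bool (e \<in> {(p, q), (r, s)}) - of_bool (e \<in> {(q, r), (p, s)})"
    and "signed_adjacency E e (q, s) = of_bool (e \<in> {(q, r), (p, s)}) - of_bool (e \<in> {(p, q), (r, s)})"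
  using arrow_first_diagonal[OF assms] arrow_second_diagonal[OF assms]
  by (simp_all add: signed_adjacency_def)

text \<open>Only triangles through one of the two diagonals change. The flip loses the arrows from
  \<open>(q, r)\<close> to \<open>(p, q)\<close> and from \<open>(p, s)\<close> to
  \<open>(r, s)\<close>, and gains those from \<open>(p, q)\<close> to \<open>(p, s)\<close> and
  from \<open>(r, s)\<close> to \<open>(q, r)\<close>. Counted with sign, these are exactly the
  two-step paths through the old diagonal.\<close>

lemma signed_adjacency_flip:
  assumes nc: "noncrossing E" and quad: "quadrilateral E p q r s" and pr: "(p, r) \<in> E"
    and e: "e \<in> E" "e \<noteq> (p, r)" and f: "f \<in> E" "f \<noteq> (p, r)"
    and nc': "noncrossing (insert (q, s) (E - {(p, r)}))" and notin: "(q, s) \<notin> E"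
  shows "signed_adjacency (insert (q, s) (E - {(p, r)})) e f = signed_adjacency E e f
    + of_bool (e \<in> {(p, q), (r, s)} \<and> f \<in> {(q, r), (p, s)})
    - of_bool (e \<in> {(q, r), (p, s)} \<and> f \<in> {(p, q), (r, s)})"
proof -
  let ?E' = "insert (q, s) (E - {(p, r)})"
  have quad': "quadrilateral ?E' p q r s" and less: "p < q" "q < r" "r < s"
    using quad by (auto simp: quadrilateral_def)
  have old: "clockwise_triangle e f (p, r) \<longleftrightarrow> (e, f) \<in> {((q, r), (p, q)), ((p, s), (r, s))}"
    if "e \<in> E" "f \<in> E" "(p, r) \<in> E" for e f
  proof
    assume tri: "clockwise_triangle e f (p, r)"
    then have "arrow E f (p, r)" "arrow E (p, r) e"
      using clockwise_triangle_rotate that unfolding arrow_def by blast+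
    then have "f \<in> {(p, q), (r, s)}" "e \<in> {(q, r), (p, s)}"
      using arrow_first_diagonal[OF nc quad] that by auto
    then show "(e, f) \<in> {((q, r), (p, q)), ((p, s), (r, s))}"
      using tri less by (auto simp: clockwise_triangle_iff)
  qed (use less in \<open>auto simp: clockwise_triangle_iff\<close>)
  have new: "clockwise_triangle e f (q, s) \<longleftrightarrow> (e, f) \<in> {((p, q), (p, s)), ((r, s), (q, r))}"
    if "e \<in> ?E'" "f \<in> ?E'" for e f
  proof
    assume tri: "clockwise_triangle e f (q, s)"
    then have "arrow ?E' f (q, s)" "arrow ?E' (q, s) e"
      using clockwise_triangle_rotate that unfolding arrow_def by blast+
    then have "f \<in> {(q, r), (p, s)}" "e \<in> {(p, q), (r, s)}"
      using arrow_second_diagonal[OF nc' quad'] that by auto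
    then show "(e, f) \<in> {((p, q), (p, s)), ((r, s), (q, r))}"
      using tri less by (auto simp: clockwise_triangle_iff)
  qed (use less in \<open>auto simp: clockwise_triangle_iff\<close>)
  have third: "t = t'" if "clockwise_triangle e f t" "clockwise_triangle e f t'" for e f t t'
    using that by (cases e; cases f) (auto simp: clockwise_triangle_iff)
  have change: "of_bool (arrow ?E' e f) = (of_bool (arrow E e f) :: int)
      - of_bool ((e, f) \<in> {((q, r), (p, q)), ((p, s), (r, s))})
      + of_bool ((e, f) \<in> {((p, q), (p, s)), ((r, s), (q, r))})"
    if "e \<in> E" "f \<in> E" "e \<noteq> (p, r)" "f \<noteq> (p, r)" for e f
  proof -
    define S where "S = (\<exists>t\<in>E - {(p, r)}. clockwise_triangle e f t)"
    have "arrow E e f \<longleftrightarrow> S \<or> clockwise_triangle e f (p, r)"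
      "arrow ?E' e f \<longleftrightarrow> S \<or> clockwise_triangle e f (q, s)"
      using pr unfolding arrow_def S_def by blast+
    moreover have "\<not> (S \<and> clockwise_triangle e f (p, r))" "\<not> (S \<and> clockwise_triangle e f (q, s))"
      using third notin unfolding S_def by blast+
    ultimately show ?thesis
      unfolding old[OF that(1,2) pr, symmetric] new[of e f, symmetric]
      using new[of e f] that by auto
  qed
  show ?thesis
    unfolding signed_adjacency_def change[OF e(1) f(1) e(2) f(2)] change[OF f(1) e(1) f(2) e(2)]
    using less by auto
qed


section \<open>Seeds realized by triangulations\<close>

definition realizes :: "nat \<Rightarrow> (nat \<times> nat \<Rightarrow> 'a::field) \<Rightarrow> 'a seed \<Rightarrow>
    (nat \<Rightarrow> nat \<times> nat) \<Rightarrow> (nat \<times> nat) set \<Rightarrow> bool" where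
  "realizes n X s D T \<longleftrightarrow> triangulation (n + 3) T \<and> bij_betw D {1..n} T \<and>
     (\<forall>i\<in>{1..n}. fst s i = X (D i)) \<and>
     (\<forall>i\<in>{1..n}. \<forall>j\<in>{1..n}. snd s i j = signed_adjacency (T \<union> sides (n + 3)) (D i) (D j))"

lemma bij_betw_flip:
  assumes "bij_betw D A T" "k \<in> A" "d' \<notin> T"
  shows "bij_betw (D(k := d')) A (insert d' (T - {D k}))"
proof -
  have "bij_betw D (A - {k}) (T - {D k})"
    using assms by (metis bij_betw_DiffI bij_betw_singletonI empty_subsetI insert_subset bij_betwE)
  then have "bij_betw (D(k := d')) (A - {k}) (T - {D k})"
    by (rule bij_betw_cong[THEN iffD1, rotated]) auto
  then have "bij_betw (D(k := d')) (insert k (A - {k})) (insert d' (T - {D k}))"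
    using notIn_Un_bij_betw[of k "A - {k}" "D(k := d')" "T - {D k}"] assms(3) by auto
  then show ?thesis
    using assms(2) by (simp add: insert_absorb)
qed

text \<open>Column \<open>k\<close> is a difference of two disjoint indicators, for which the
  correction of matrix mutation counts paths from \<open>i\<close> through \<open>k\<close> to
  \<open>j\<close> minus paths back. That is the change produced by the flip.\<close>

lemma mutate_signed_adjacency_first:
  assumes T: "triangulation N T" and N: "N \<ge> 3" and D: "bij_betw D A T" and k: "k \<in> A"
    and quad: "quadrilateral (T \<union> sides N) p q r s" and d: "D k = (p, r)"
    and ij: "i \<in> A" "j \<in> A"
  shows "mutate_matrix k (\<lambda>i j. signed_adjacency (T \<union> sides N) (D i) (D j)) i j =
    signed_adjacency (insert (q, s) (T - {(p, r)}) \<union> sides N) ((D(k := (q, s))) i) ((D(k := (q, s))) j)"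
proof -
  let ?E = "T \<union> sides N" and ?T' = "insert (q, s) (T - {(p, r)})"
  have fl: "flip ?E (p, r) (q, s)"
    using quad unfolding flip_def by blast
  have prT: "(p, r) \<in> T"
    using D k d bij_betwE by metis
  note flipped = flip_triangulation[OF T N prT fl]
  have E': "?T' \<union> sides N = insert (q, s) (?E - {(p, r)})"
    using flipped(4) by auto
  have less: "p < q" "q < r" "r < s"
    using quad by (auto simp: quadrilateral_def)
  note nc = triangulation_noncrossing[OF T N]
    and nc' = triangulation_noncrossing[OF flipped(1) N]
  have quad': "quadrilateral (?T' \<union> sides N) p q r s"
    using quad unfolding E' quadrilateral_def by auto
  have old: "D i \<in> ?E" "D i \<noteq> (p, r)" "D i \<in> ?T' \<union> sides N" "D i \<noteq> (q, s)" if "i \<in> A" "i \<noteq> k" for i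
  proof -
    show "D i \<in> ?E" "D i \<noteq> (p, r)"
      using that k bij_betwE[OF D] inj_on_eq_iff[OF bij_betw_imp_inj_on[OF D]]
      unfolding d[symmetric] by blast+
    then show "D i \<in> ?T' \<union> sides N" "D i \<noteq> (q, s)"
      using flipped(2) E' by auto
  qed
  note adj = signed_adjacency_diagonals(1)[OF nc quad] and adj' = signed_adjacency_diagonals(2)[OF nc' quad']
  show ?thesis
  proof (cases "i = k \<or> j = k")
    case True
    consider "i = k" "j = k" | "i = k" "j \<noteq> k" | "i \<noteq> k" "j = k"
      using True by blast
    then show ?thesis
    proof cases
      case 1
      then show ?thesis
        by (simp add: mutate_matrix_def signed_adjacency_def)
    next
      case 2
      then show ?thesis
        using adj[OF old(1)[of j]] adj'[OF old(3)[of j]] ij d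
          signed_adjacency_skew[of _ "D j"]
        by (simp add: mutate_matrix_def)
    next
      case 3
      then show ?thesis
        using adj[OF old(1)[of i]] adj'[OF old(3)[of i]] ij d
        by (simp add: mutate_matrix_def)
    qed
  next
    case False
    then have "i \<noteq> k" "j \<noteq> k"
      by auto
    note i = old[OF ij(1) \<open>i \<noteq> k\<close>] and j = old[OF ij(2) \<open>j \<noteq> k\<close>]
    have fl_adj: "signed_adjacency (?T' \<union> sides N) (D i) (D j) = signed_adjacency ?E (D i) (D j)
      + of_bool (D i \<in> {(p, q), (r, s)} \<and> D j \<in> {(q, r), (p, s)})
      - of_bool (D i \<in> {(q, r), (p, s)} \<and> D j \<in> {(p, q), (r, s)})"
      unfolding E'
      using signed_adjacency_flip[OF nc quad _ i(1,2) j(1,2)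
          nc'[unfolded E'] flipped(2)] prT
      by blast
    have i_adj: "signed_adjacency ?E (D i) (p, r) =
        of_bool (D i \<in> {(p, q), (r, s)}) - of_bool (D i \<in> {(q, r), (p, s)})"
      and j_adj: "signed_adjacency ?E (p, r) (D j) =
        of_bool (D j \<in> {(q, r), (p, s)}) - of_bool (D j \<in> {(p, q), (r, s)})"
      using adj[OF i(1)] adj[OF j(1)] signed_adjacency_skew[of ?E "(p, r)" "D j"] False by auto
    have disj: "\<not> (e \<in> {(p, q), (r, s)} \<and> e \<in> {(q, r), (p, s)})" for e
      using less by auto
    show ?thesis
      using False disj[of "D i"] disj[of "D j"]
      by (simp add: mutate_matrix_def d fl_adj i_adj j_adj pos_part_def del: insert_iff Un_insert_left; blast)
  qed
qed

text \<open>Flipping \<open>(q, s)\<close> to \<open>(p, r)\<close> reverses a flip of the kind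
  already treated, so the claim follows from involutivity of matrix mutation.\<close>

lemma mutate_signed_adjacency:
  assumes T: "triangulation N T" and N: "N \<ge> 3" and D: "bij_betw D A T" and k: "k \<in> A"
    and fl: "flip (T \<union> sides N) (D k) d'" and ij: "i \<in> A" "j \<in> A"
  shows "mutate_matrix k (\<lambda>i j. signed_adjacency (T \<union> sides N) (D i) (D j)) i j =
    signed_adjacency (insert d' (T - {D k}) \<union> sides N) ((D(k := d')) i) ((D(k := d')) j)"
proof -
  let ?T' = "insert d' (T - {D k})" and ?D' = "D(k := d')"
  have dT: "D k \<in> T"
    using D k bij_betwE by blast
  note flipped = flip_triangulation[OF T N dT fl]
  from fl obtain p q r s where quad: "quadrilateral (T \<union> sides N) p q r s"
    and "D k = (p, r) \<and> d' = (q, s) \<or> D k = (q, s) \<and> d' = (p, r)"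
    unfolding flip_def by blast
  then consider "D k = (p, r)" "d' = (q, s)" | "D k = (q, s)" "d' = (p, r)"
    by blast
  then show ?thesis
  proof cases
    case 1
    then show ?thesis
      using mutate_signed_adjacency_first[OF T N D k quad 1(1) ij] by simp
  next
    case 2
    let ?M = "\<lambda>i j. signed_adjacency (T \<union> sides N) (D i) (D j)"
    let ?M' = "\<lambda>i j. signed_adjacency (?T' \<union> sides N) (?D' i) (?D' j)"
    have D': "bij_betw ?D' A ?T'"
      using bij_betw_flip[OF D k] flipped(2) by blast
    have quad': "quadrilateral (?T' \<union> sides N) p q r s"
      using quad 2 flipped(2) unfolding quadrilateral_def by auto
    have undo: "insert (q, s) (?T' - {(p, r)}) = T" "?D'(k := (q, s)) = D"
      using 2 dT flipped(2) by auto
    have "?D' k = (p, r)"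
      using 2 by simp
    then have "mutate_matrix k ?M' i j = ?M i j" if "i \<in> A" "j \<in> A" for i j
      using mutate_signed_adjacency_first[OF flipped(1) N D' k quad' _ that] unfolding undo by blast
    then have "mutate_matrix k (mutate_matrix k ?M') i j = mutate_matrix k ?M i j"
      using mutate_matrix_cong[of A "mutate_matrix k ?M'" ?M k i j] k ij by blast
    then show ?thesis
      by (simp only: mutate_matrix_involutive)
  qed
qed

text \<open>An edge outside \<open>T\<close> may be put into the product because its value is 1; in
  the application such edges are sides of the polygon.\<close>

lemma prod_two_edges:
  fixes X :: "nat \<times> nat \<Rightarrow> 'a::field"
  assumes "finite T" "e \<noteq> f" "e \<notin> T \<Longrightarrow> X e = 1" "f \<notin> T \<Longrightarrow> X f = 1"
  shows "(\<Prod>d\<in>T. X d ^ (of_bool (d \<in> {e, f}))) = X e * X f"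
proof -
  have "(\<Prod>d\<in>T. X d ^ (of_bool (d \<in> {e, f}))) = (\<Prod>d\<in>T \<union> {e, f}. X d ^ (of_bool (d \<in> {e, f})))"
    by (rule prod.mono_neutral_left) (use assms in auto)
  also have "\<dots> = (\<Prod>d\<in>{e, f}. X d ^ (of_bool (d \<in> {e, f})))"
    by (rule prod.mono_neutral_right) (use assms in auto)
  also have "\<dots> = X e * X f"
    using assms(2) by simp
  finally show ?thesis .
qed

lemma exchange_frieze:
  assumes T: "triangulation (n + 3) T" and D: "bij_betw D {1..n} T" and k: "k \<in> {1..n}"
    and X: "frieze (n + 3) X" and fl: "flip (T \<union> sides (n + 3)) (D k) d'"
    and x: "\<And>i. i \<in> {1..n} \<Longrightarrow> x i = X (D i)"
    and B: "\<And>i. i \<in> {1..n} \<Longrightarrow> B i k = signed_adjacency (T \<union> sides (n + 3)) (D i) (D k)"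
  shows "exchange n k x B = X (D k) * X d'"
proof -
  let ?E = "T \<union> sides (n + 3)"
  from fl obtain p q r s where quad: "quadrilateral ?E p q r s"
    and d: "D k = (p, r) \<and> d' = (q, s) \<or> D k = (q, s) \<and> d' = (p, r)"
    unfolding flip_def by blast
  have N: "n + 3 \<ge> 3"
    by simp
  note nc = triangulation_noncrossing[OF T N]
  have less: "p < q" "q < r" "r < s" "s < n + 3"
    and E: "(p, q) \<in> ?E" "(q, r) \<in> ?E" "(r, s) \<in> ?E" "(p, s) \<in> ?E"
    using quad triangulation_edge_bounds[OF T N] unfolding quadrilateral_def by blast+
  have side: "X e = 1" if "e \<in> ?E" "e \<notin> T" for e
    using that X unfolding frieze_def sides_def by auto
  have fin: "finite T"
    using D bij_betw_finite by blast
  have reindex: "(\<Prod>i\<in>{1..n}. X (D i) ^ g (D i)) = (\<Prod>e\<in>T. X e ^ g e)" for g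
    using prod.reindex_bij_betw[OF D] .
  have ne: "(p, q) \<noteq> (r, s)" "(q, r) \<noteq> (p, s)"
    using less by auto
  have prods: "(\<Prod>e\<in>T. X e ^ of_bool (e \<in> {(p, q), (r, s)})) = X (p, q) * X (r, s)"
    "(\<Prod>e\<in>T. X e ^ of_bool (e \<in> {(q, r), (p, s)})) = X (q, r) * X (p, s)"
    using prod_two_edges[OF fin ne(1) side[OF E(1)] side[OF E(3)]]
      prod_two_edges[OF fin ne(2) side[OF E(2)] side[OF E(4)]] by blast+
  have disj: "\<not> (e \<in> {(p, q), (r, s)} \<and> e \<in> {(q, r), (p, s)})"
    "\<not> (e \<in> {(q, r), (p, s)} \<and> e \<in> {(p, q), (r, s)})" for e
    using less by auto
  have pos: "nat (pos_part (of_bool P - of_bool Q)) = of_bool P"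
    "nat (pos_part (- (of_bool P - of_bool Q))) = of_bool Q" if "\<not> (P \<and> Q)" for P Q
    using that by (auto simp: pos_part_def)
  have first: "nat (pos_part (signed_adjacency ?E e (p, r))) = of_bool (e \<in> {(p, q), (r, s)})"
      "nat (pos_part (- signed_adjacency ?E e (p, r))) = of_bool (e \<in> {(q, r), (p, s)})"
    and second: "nat (pos_part (signed_adjacency ?E e (q, s))) = of_bool (e \<in> {(q, r), (p, s)})"
      "nat (pos_part (- signed_adjacency ?E e (q, s))) = of_bool (e \<in> {(p, q), (r, s)})"
    if "e \<in> T" for e
    using signed_adjacency_diagonals[OF nc quad UnI1[OF that]]
    by (simp_all only: pos[OF disj(1)] pos[OF disj(2)])
  have ex: "exchange n k x B =
      (\<Prod>e\<in>T. X e ^ nat (pos_part (signed_adjacency ?E e (D k)))) +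
      (\<Prod>e\<in>T. X e ^ nat (pos_part (- signed_adjacency ?E e (D k))))"
    unfolding exchange_def reindex[symmetric] by (simp add: x B)
  have "exchange n k x B = X (p, q) * X (r, s) + X (q, r) * X (p, s)"
    using d
  proof (elim disjE conjE)
    assume "D k = (p, r)"
    then show ?thesis
      unfolding ex prods[symmetric]
      by (simp add: first cong: prod.cong del: insert_iff)
  next
    assume "D k = (q, s)"
    then show ?thesis
      unfolding ex prods[symmetric]
      by (simp add: second cong: prod.cong del: insert_iff)
  qed
  also have "\<dots> = X (p, r) * X (q, s)"
    using X less unfolding frieze_def by (simp add: mult.commute)
  also have "\<dots> = X (D k) * X d'"
    using d by (auto simp: mult.commute)
  finally show ?thesis .
qed

lemma realizes_mutate:
  assumes real: "realizes n X s D T" and k: "k \<in> {1..n}"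
    and X: "frieze (n + 3) X" "\<And>d. d \<in> diagonals (n + 3) \<Longrightarrow> X d \<noteq> 0"
    and fl: "flip (T \<union> sides (n + 3)) (D k) d'"
  shows "realizes n X (mutate_seed n k s) (D(k := d')) (insert d' (T - {D k}))"
proof -
  have T: "triangulation (n + 3) T" and D: "bij_betw D {1..n} T"
    and x: "\<And>i. i \<in> {1..n} \<Longrightarrow> fst s i = X (D i)"
    and B: "\<And>i j. i \<in> {1..n} \<Longrightarrow> j \<in> {1..n} \<Longrightarrow>
      snd s i j = signed_adjacency (T \<union> sides (n + 3)) (D i) (D j)"
    using real unfolding realizes_def by auto
  have N: "n + 3 \<ge> 3"
    by simp
  have dT: "D k \<in> T"
    using D k bij_betwE by blast
  note flipped = flip_triangulation[OF T N dT fl]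
  have "D k \<in> diagonals (n + 3)"
    using T dT by (auto simp: triangulation_def polygon_complex_def)
  then have "X (D k) \<noteq> 0"
    by (rule X(2))
  moreover have "exchange n k (fst s) (snd s) = X (D k) * X d'"
    by (rule exchange_frieze[OF T D k X(1) fl]) (use x B k in auto)
  ultimately have "fst (mutate_seed n k s) i = X ((D(k := d')) i)" if "i \<in> {1..n}" for i
    using that x k by (simp add: mutate_seed_def mutate_cluster_exchange)
  moreover have "snd (mutate_seed n k s) i j =
      signed_adjacency (insert d' (T - {D k}) \<union> sides (n + 3)) ((D(k := d')) i) ((D(k := d')) j)"
    if "i \<in> {1..n}" "j \<in> {1..n}" for i j
    using mutate_signed_adjacency[OF T N D k fl that] that k
      mutate_matrix_cong[of "{1..n}" "snd s"
        "\<lambda>i j. signed_adjacency (T \<union> sides (n + 3)) (D i) (D j)" k i j] B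
    by (simp add: mutate_seed_def)
  moreover have "bij_betw (D(k := d')) {1..n} (insert d' (T - {D k}))"
    using bij_betw_flip[OF D k] flipped(2) by blast
  ultimately show ?thesis
    using flipped(1) unfolding realizes_def by blast
qed

lemma realizes_cluster: "realizes n X s D T \<Longrightarrow> fst s ` {1..n} = X ` T"
  unfolding realizes_def bij_betw_def by force

lemma reachable_realizes:
  assumes X: "frieze (n + 3) X" "\<And>d. d \<in> diagonals (n + 3) \<Longrightarrow> X d \<noteq> 0"
    and s: "realizes n X s D\<^sub>0 (fan (n + 3))" and t: "t \<in> reachable_seeds n s"
  shows "\<exists>D T. realizes n X t D T"
  using t
proof induction
  case initial
  then show ?case
    using s by blast
next
  case (mutate t k)
  then obtain D T where t: "realizes n X t D T"
    by blast
  then have T: "triangulation (n + 3) T" "D k \<in> T"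
    using mutate.hyps(2) bij_betwE unfolding realizes_def by blast+
  obtain d' where "flip (T \<union> sides (n + 3)) (D k) d'"
    using diagonal_of_quadrilateral[OF T(1) _ T(2)] unfolding flip_def
    by (metis le_add2)
  then show ?case
    using realizes_mutate[OF t mutate.hyps(2) X] by blast
qed

text \<open>A flip of \<open>d\<close> is matched by the mutation at the index carrying
  \<open>d\<close>, so flip-connectedness with the fan yields a reachable seed.\<close>

lemma triangulation_realized:
  assumes X: "frieze (n + 3) X" "\<And>d. d \<in> diagonals (n + 3) \<Longrightarrow> X d \<noteq> 0"
    and s: "realizes n X s D\<^sub>0 (fan (n + 3))" and T: "triangulation (n + 3) T"
  shows "\<exists>t\<in>reachable_seeds n s. \<exists>D. realizes n X t D T"
proof -
  have "n + 3 \<ge> 3"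
    by simp
  with T show ?thesis
  proof (induction T rule: triangulation_flip_induct)
    case fan
    then show ?case
      using s reachable_seeds.initial by blast
  next
    case (flip T d d')
    then obtain t D where t: "t \<in> reachable_seeds n s" "realizes n X t D T"
      by blast
    then have "bij_betw D {1..n} T"
      by (simp add: realizes_def)
    then obtain k where "k \<in> {1..n}" "D k = d"
      using \<open>d \<in> T\<close> by (metis bij_betw_imp_surj_on imageE)
    then show ?case
      using realizes_mutate[OF t(2) _ X] flip.hyps t(1) reachable_seeds.mutate by metis
  qed
qed

text \<open>Subsets of triangulations are the same as noncrossing sets, since each of the latter
  extends to a triangulation.\<close>

theorem cluster_complex_realized:
  assumes X: "frieze (n + 3) X" "\<And>d. d \<in> diagonals (n + 3) \<Longrightarrow> X d \<noteq> 0"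
    and s: "realizes n X s D\<^sub>0 (fan (n + 3))"
  shows "cluster_complex n s = (\<lambda>S. X ` S) ` polygon_complex (n + 3)"
proof
  show "cluster_complex n s \<subseteq> (\<lambda>S. X ` S) ` polygon_complex (n + 3)"
  proof
    fix \<sigma>
    assume "\<sigma> \<in> cluster_complex n s"
    then obtain t where t: "t \<in> reachable_seeds n s" "\<sigma> \<subseteq> fst t ` {1..n}"
      by (auto simp: cluster_complex_def)
    then obtain D T where T: "realizes n X t D T"
      using reachable_realizes[OF X s] by blast
    then obtain S where S: "S \<subseteq> T" "\<sigma> = X ` S"
      using t(2) realizes_cluster[OF T] by (metis subset_imageE)
    have "T \<in> polygon_complex (n + 3)"
      using T by (simp add: realizes_def triangulation_def)
    then have "S \<in> polygon_complex (n + 3)"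
      using S(1) by (auto simp: polygon_complex_def noncrossing_def)
    then show "\<sigma> \<in> (\<lambda>S. X ` S) ` polygon_complex (n + 3)"
      using S(2) by blast
  qed
  show "(\<lambda>S. X ` S) ` polygon_complex (n + 3) \<subseteq> cluster_complex n s"
  proof
    fix \<sigma>
    assume "\<sigma> \<in> (\<lambda>S. X ` S) ` polygon_complex (n + 3)"
    then obtain S where S: "S \<in> polygon_complex (n + 3)" "\<sigma> = X ` S"
      by blast
    obtain T where T: "triangulation (n + 3) T" "S \<subseteq> T"
      using triangulation_extends[OF S(1)] .
    obtain t D where t: "t \<in> reachable_seeds n s" "realizes n X t D T"
      using triangulation_realized[OF X s T(1)] by blast
    have "\<sigma> \<subseteq> fst t ` {1..n}"
      using realizes_cluster[OF t(2)] S(2) T(2) by auto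
    then show "\<sigma> \<in> cluster_complex n s"
      using t(1) by (auto simp: cluster_complex_def)
  qed
qed


section \<open>Quivers of type A\<close>

text \<open>\<open>p\<close> lists the indices along the path, and \<open>\<epsilon> i\<close> is
  the entry on its \<open>i\<close>-th edge, positive for arrows from \<open>p i\<close> to
  \<open>p (Suc i)\<close>. Only the values of \<open>\<epsilon>\<close> at \<open>1\<close>, ...,
  \<open>n - 1\<close> are consulted.\<close>

definition path_matrix :: "nat \<Rightarrow> (nat \<Rightarrow> nat) \<Rightarrow> (nat \<Rightarrow> int) \<Rightarrow> int_matrix \<Rightarrow> bool" where
  "path_matrix n p \<epsilon> B \<longleftrightarrow> (\<forall>i\<in>{1..n}. \<forall>j\<in>{1..n}.
     B (p i) (p j) = (if j = Suc i then \<epsilon> i else if i = Suc j then - \<epsilon> j else 0))"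

lemma path_matrix_cong:
  "path_matrix n p \<epsilon> B \<Longrightarrow> (\<And>i. 1 \<le> i \<Longrightarrow> i < n \<Longrightarrow> \<epsilon> i = \<epsilon>' i) \<Longrightarrow> path_matrix n p \<epsilon>' B"
  unfolding path_matrix_def by auto

text \<open>The third side of a triangle on two fan diagonals avoids \<open>0\<close>, so it is a
  side of the polygon and their end points are consecutive.\<close>

lemma signed_adjacency_fan:
  assumes "2 \<le> i" "i < n + 2" "2 \<le> j" "j < n + 2"
  shows "signed_adjacency (fan (n + 3) \<union> sides (n + 3)) (0, i) (0, j) =
    of_bool (j = Suc i) - of_bool (i = Suc j)"
proof -
  have "arrow (fan (n + 3) \<union> sides (n + 3)) (0, i) (0, j) \<longleftrightarrow> j = Suc i"
    if "2 \<le> i" "i < n + 2" "2 \<le> j" "j < n + 2" for i j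
    using that by (auto simp: arrow_def clockwise_triangle_iff fan_def sides_def)
  then show ?thesis
    using assms by (simp add: signed_adjacency_def)
qed

theorem linear_cluster_complex:
  fixes x :: "nat \<Rightarrow> 'a::field"
  assumes good: "good_seed n (x, B)" and p: "bij_betw p {1..n} {1..n}"
    and B: "path_matrix n p (\<lambda>_. 1) B"
  obtains X where "inj_on X (diagonals (n + 3))" "x ` {1..n} = X ` fan (n + 3)"
    "cluster_complex n (x, B) = (\<lambda>S. X ` S) ` polygon_complex (n + 3)"
proof -
  have x: "specializable n x"
    using good by (simp add: good_seed_def)
  obtain X where X: "frieze (n + 3) X" and fan: "\<And>j. j \<in> {1..n} \<Longrightarrow> X (0, Suc j) = x (p j)"
    and nonzero: "\<And>d. d \<in> diagonals (n + 3) \<Longrightarrow> X d \<noteq> 0" and inj: "inj_on X (diagonals (n + 3))"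
    by (rule specializable_frieze[OF x p]) blast
  \<comment> \<open>\<open>q i\<close> is the position of the index \<open>i\<close> on the path; it
    is shifted by one in \<open>D\<close> because the fan begins with \<open>(0, 2)\<close>.\<close>
  define q where "q = inv_into {1..n} p"
  have q: "bij_betw q {1..n} {1..n}" "\<And>i. i \<in> {1..n} \<Longrightarrow> p (q i) = i"
    using p bij_betw_inv_into[OF p] bij_betw_inv_into_right[OF p] by (auto simp: q_def)
  have q_in: "q i \<in> {1..n}" if "i \<in> {1..n}" for i
    using q(1) that bij_betwE by blast
  have "bij_betw (\<lambda>j. (0 :: nat, Suc j)) {1..n} (fan (n + 3))"
    by (rule bij_betwI[where g = "\<lambda>d. snd d - 1"]) (auto simp: fan_def)
  then have D: "bij_betw (\<lambda>i. (0, Suc (q i))) {1..n} (fan (n + 3))"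
    using bij_betw_trans[OF q(1)] by (auto simp: comp_def)
  have adj: "B i j = signed_adjacency (fan (n + 3) \<union> sides (n + 3)) (0, Suc (q i)) (0, Suc (q j))"
    if "i \<in> {1..n}" "j \<in> {1..n}" for i j
  proof -
    have "B (p (q i)) (p (q j)) = of_bool (q j = Suc (q i)) - of_bool (q i = Suc (q j))"
      using B q_in[OF that(1)] q_in[OF that(2)] unfolding path_matrix_def by auto
    then show ?thesis
      using signed_adjacency_fan[of "Suc (q i)" n "Suc (q j)"] q(2) that q_in[OF that(1)] q_in[OF that(2)]
      by simp
  qed
  have real: "realizes n X (x, B) (\<lambda>i. (0, Suc (q i))) (fan (n + 3))"
    unfolding realizes_def using triangulation_fan D adj fan[OF q_in] q(2) by auto
  show ?thesis
    using that[OF inj] realizes_cluster[OF real] cluster_complex_realized[OF X nonzero real] by simp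
qed

section \<open>Reorienting a path by mutations\<close>

text \<open>By \<open>turn\<close>, vertex \<open>k\<close> is the first one of the path or no
  directed path runs through it. The correction term vanishes, and mutation just reverses the arrows
  at \<open>k\<close>. For \<open>k = 1\<close> the update at index 0 falls outside the consulted
  range.\<close>

lemma path_matrix_mutate:
  assumes B: "path_matrix n p \<epsilon> B" and p: "inj_on p {1..n}" and k: "1 \<le> k" "k < n"
    and turn: "k = 1 \<or> \<epsilon> (k - 1) = - \<epsilon> k"
  shows "path_matrix n p (\<epsilon>(k := - \<epsilon> k, k - 1 := - \<epsilon> (k - 1))) (mutate_matrix (p k) B)"
  unfolding path_matrix_def
proof (intro ballI)
  fix i j
  assume ij: "i \<in> {1..n}" "j \<in> {1..n}"
  have eq: "p i = p k \<longleftrightarrow> i = k" "p j = p k \<longleftrightarrow> j = k"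
    using p ij k by (auto dest: inj_onD)
  have entry: "B (p i) (p j) = (if j = Suc i then \<epsilon> i else if i = Suc j then - \<epsilon> j else 0)"
    if "i \<in> {1..n}" "j \<in> {1..n}" for i j
    using B that unfolding path_matrix_def by blast
  have kn: "k \<in> {1..n}"
    using k by auto
  show "mutate_matrix (p k) B (p i) (p j) = (if j = Suc i then (\<epsilon>(k := - \<epsilon> k, k - 1 := - \<epsilon> (k - 1))) i
      else if i = Suc j then - (\<epsilon>(k := - \<epsilon> k, k - 1 := - \<epsilon> (k - 1))) j else 0)"
  proof (cases "i = k \<or> j = k")
    case True
    then show ?thesis
      using ij k by (auto simp: mutate_matrix_def eq entry[OF ij])
  next
    case False
    then have "i \<noteq> k" "j \<noteq> k"
      by auto
    have "pos_part (B (p i) (p k)) * B (p k) (p j) + B (p i) (p k) * pos_part (- B (p k) (p j)) = 0"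
      using turn ij False unfolding entry[OF ij(1) kn] entry[OF kn ij(2)]
      by (auto simp: pos_part_def)
    then show ?thesis
      using False ij by (auto simp: mutate_matrix_def eq entry[OF ij])
  qed
qed

text \<open>If edge \<open>k\<close> is wrong while all earlier ones are right, its left end is a
  source or sink. Mutating there corrects edge \<open>k\<close> and spoils edge
  \<open>k - 1\<close>; the defect thus wanders to the left until it leaves the path.\<close>

lemma path_orient_edge:
  assumes p: "bij_betw p {1..n} {1..n}" and "k < n"
    and "path_matrix n p \<epsilon> (snd s)" "1 \<le> k" "\<And>i. 1 \<le> i \<Longrightarrow> i < k \<Longrightarrow> \<epsilon> i = 1" "\<bar>\<epsilon> k\<bar> = 1"
  shows "\<exists>t\<in>reachable_seeds n s. path_matrix n p (\<epsilon>(k := 1)) (snd t)"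
  using assms(2-)
proof (induction k arbitrary: s \<epsilon>)
  case 0
  then show ?case by simp
next
  case (Suc k)
  show ?case
  proof (cases "\<epsilon> (Suc k) = 1")
    case True
    then have "path_matrix n p (\<epsilon>(Suc k := 1)) (snd s)"
      using path_matrix_cong[OF Suc.prems(2)] by simp
    then show ?thesis
      using reachable_seeds.initial by blast
  next
    case False
    then have minus: "\<epsilon> (Suc k) = - 1"
      using Suc.prems(5) by linarith
    let ?s = "mutate_seed n (p (Suc k)) s"
    let ?\<epsilon> = "\<epsilon>(Suc k := 1, k := - \<epsilon> k)"
    have "Suc k \<in> {1..n}"
      using Suc.prems by simp
    then have "p (Suc k) \<in> {1..n}"
      using p bij_betwE by blast
    then have reach: "?s \<in> reachable_seeds n s"
      using reachable_seeds.mutate[OF reachable_seeds.initial] by blast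
    have "Suc k = 1 \<or> \<epsilon> (Suc k - 1) = - \<epsilon> (Suc k)"
      using Suc.prems(4)[of k] minus by (cases "k = 0") auto
    then have path: "path_matrix n p ?\<epsilon> (snd ?s)"
      using path_matrix_mutate[OF Suc.prems(2) bij_betw_imp_inj_on[OF p], of "Suc k"] Suc.prems(1) minus
      by (simp add: mutate_seed_def)
    show ?thesis
    proof (cases "k = 0")
      case True
      then have "path_matrix n p (\<epsilon>(Suc k := 1)) (snd ?s)"
        using path_matrix_cong[OF path] by simp
      then show ?thesis
        using reach by blast
    next
      case False
      then have "\<exists>t\<in>reachable_seeds n ?s. path_matrix n p (?\<epsilon>(k := 1)) (snd t)"
        using Suc.prems by (intro Suc.IH[OF _ path]) auto
      moreover have "path_matrix n p (\<epsilon>(Suc k := 1)) M" if "path_matrix n p (?\<epsilon>(k := 1)) M" for M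
        by (rule path_matrix_cong[OF that]) (use Suc.prems(4)[of k] False in auto)
      ultimately show ?thesis
        using reach reachable_seeds_trans by blast
    qed
  qed
qed

text \<open>The edges are treated in increasing order; correcting one leaves all the others as they
  were in the end.\<close>

lemma path_orient:
  assumes p: "bij_betw p {1..n} {1..n}"
    and "path_matrix n p \<epsilon> (snd s)" "\<And>i. 1 \<le> i \<Longrightarrow> i < n \<Longrightarrow> \<bar>\<epsilon> i\<bar> = 1"
  shows "\<exists>t\<in>reachable_seeds n s. path_matrix n p (\<lambda>_. 1) (snd t)"
proof -
  have "\<exists>t\<in>reachable_seeds n s. path_matrix n p (\<lambda>i. if i < m then 1 else \<epsilon> i) (snd t)"
    if "m \<le> n" for m
    using that
  proof (induction m)
    case 0
    show ?case
      by (rule bexI[OF _ reachable_seeds.initial]) (use assms(2) in simp)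
  next
    case (Suc m)
    then obtain t where t: "t \<in> reachable_seeds n s"
      "path_matrix n p (\<lambda>i. if i < m then 1 else \<epsilon> i) (snd t)"
      by auto
    have "\<exists>t'\<in>reachable_seeds n t. path_matrix n p (\<lambda>i. if i < Suc m then 1 else \<epsilon> i) (snd t')"
    proof (cases "m = 0")
      case True
      then show ?thesis
        by (intro bexI[OF _ reachable_seeds.initial] path_matrix_cong[OF t(2)]) auto
    next
      case False
      then have "\<exists>t'\<in>reachable_seeds n t.
          path_matrix n p ((\<lambda>i. if i < m then 1 else \<epsilon> i)(m := 1)) (snd t')"
        using Suc.prems assms(3) by (intro path_orient_edge[OF p _ t(2)]) auto
      moreover have "(\<lambda>i. if i < m then 1 else \<epsilon> i)(m := 1) = (\<lambda>i. if i < Suc m then 1 else \<epsilon> i)"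
        by auto
      ultimately show ?thesis
        by metis
    qed
    then show ?case
      using t(1) reachable_seeds_trans by blast
  qed
  from this[of n] obtain t where t: "t \<in> reachable_seeds n s"
    "path_matrix n p (\<lambda>i. if i < n then 1 else \<epsilon> i) (snd t)"
    by blast
  show ?thesis
    by (intro bexI[OF _ t(1)] path_matrix_cong[OF t(2)]) simp
qed

lemma mutation_equivalent_reachable:
  assumes "mutation_equivalent n (snd s) C"
  shows "\<exists>t\<in>reachable_seeds n s. snd t = C"
  using assms
proof induction
  case initial
  then show ?case
    using reachable_seeds.initial by blast
next
  case (mutate C k)
  then obtain t where "t \<in> reachable_seeds n s" "snd t = C"
    by blast
  then show ?case
    by (intro bexI[OF _ reachable_seeds.mutate[of t n s k]]) (use mutate.hyps in \<open>auto simp: mutate_seed_def\<close>)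
qed

section \<open>Reading path matrices off quivers\<close>

lemma count_image_mset_set:
  assumes "finite A"
  shows "count (image_mset f (mset_set A)) y = card {a \<in> A. f a = y}"
proof -
  have "count (image_mset f (mset_set A)) y = (\<Sum>a\<in>f -` {y} \<inter> A. count (mset_set A) a)"
    by (simp add: count_image_mset assms)
  also have "\<dots> = (\<Sum>a\<in>{a \<in> A. f a = y}. 1)"
    by (rule sum.cong) (auto simp: assms)
  finally show ?thesis
    by simp
qed

text \<open>For distinct \<open>i\<close> and \<open>j\<close>, the multiplicity of the edge between
  them is \<open>nat (B i j) + nat (B j i)\<close>, which by skew-symmetry is the absolute value of
  \<open>B i j\<close>.\<close>

lemma quiver_dynkin_A:
  assumes skew: "skew_symmetric n B" and graph: "underlying_graph (quiver n B) = dynkin_A n"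
    and ij: "i \<in> {1..n}" "j \<in> {1..n}"
  shows "\<bar>B i j\<bar> = of_bool (j = Suc i \<or> i = Suc j)"
proof (cases "i = j")
  case True
  have "B i i = - B i i"
    using skew ij unfolding skew_symmetric_def by blast
  then show ?thesis
    using True by simp
next
  case False
  let ?A = "arcs (quiver n B)"
  let ?ends = "\<lambda>a. {tail (quiver n B) a, head (quiver n B) a}"
  have A: "?A = (\<Union>i\<in>{1..n}. \<Union>j\<in>{1..n}. (\<lambda>m. (i, j, m)) ` {..<nat (B i j)})"
    by (auto simp: quiver_def image_iff zless_nat_eq_int_zless)
  \<comment> \<open>\<open>mset_set\<close> is empty on infinite sets; finiteness makes
    multiplicities count arrows.\<close>
  have fin: "finite ?A"
    unfolding A by auto
  have "image_mset ?ends (mset_set ?A) = mset_set ((\<lambda>i. {i, Suc i}) ` {1..<n})"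
    using graph by (simp add: underlying_graph_def dynkin_A_def)
  then have "count (image_mset ?ends (mset_set ?A)) {i, j}
      = count (mset_set ((\<lambda>i. {i, Suc i}) ` {1..<n})) {i, j}"
    by simp
  also have "count (image_mset ?ends (mset_set ?A)) {i, j} = card {a \<in> ?A. ?ends a = {i, j}}"
    by (rule count_image_mset_set[OF fin])
  also have "{a \<in> ?A. ?ends a = {i, j}} =
      (\<lambda>m. (i, j, m)) ` {..<nat (B i j)} \<union> (\<lambda>m. (j, i, m)) ` {..<nat (B j i)}"
    using ij False by (auto simp: quiver_def doubleton_eq_iff)
  also have "card \<dots> = nat (B i j) + nat (B j i)"
    using False by (subst card_Un_disjoint) (auto simp: card_image inj_on_def)
  also have "count (mset_set ((\<lambda>i. {i, Suc i}) ` {1..<n})) {i, j} = of_bool (j = Suc i \<or> i = Suc j)"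
    using ij by (auto simp: count_mset_set' doubleton_eq_iff)
  finally have "nat (B i j) + nat (B j i) = of_bool (j = Suc i \<or> i = Suc j)" .
  moreover have "B j i = - B i j"
    using skew ij unfolding skew_symmetric_def by blast
  ultimately show ?thesis
    by (auto split: if_splits)
qed

text \<open>Some reachable seed has a path quiver, and reorienting this path leads to a linear one
  with the same cluster complex. For \<open>n = 0\<close> the polygon is a triangle without
  diagonals, and the complex is \<open>{{}}\<close>.\<close>

lemma A_type_cluster_complex:
  assumes good: "good_seed n (x, B)" and A: "A_type n B"
  obtains X where "inj_on X (diagonals (n + 3))"
    "cluster_complex n (x, B) = (\<lambda>S. X ` S) ` polygon_complex (n + 3)"
proof -
  obtain B' C p where C: "mutation_equivalent n B C" and p: "bij_betw p {1..n} {1..n}"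
    and B': "\<And>i j. i \<in> {1..n} \<Longrightarrow> j \<in> {1..n} \<Longrightarrow> B' i j = C (p i) (p j)"
    and skew: "skew_symmetric n B'" and graph: "underlying_graph (quiver n B') = dynkin_A n"
    using A unfolding A_type_def mutation_equivalent_up_to_relabeling_def by blast
  obtain t where t: "t \<in> reachable_seeds n (x, B)" "snd t = C"
    using mutation_equivalent_reachable[of n "(x, B)" C] C by auto
  have entry: "\<bar>B' i j\<bar> = of_bool (j = Suc i \<or> i = Suc j)" if "i \<in> {1..n}" "j \<in> {1..n}" for i j
    by (rule quiver_dynkin_A[OF skew graph that])
  have "path_matrix n p (\<lambda>i. B' i (Suc i)) (snd t)"
    unfolding path_matrix_def
  proof (intro ballI)
    fix i j
    assume ij: "i \<in> {1..n}" "j \<in> {1..n}"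
    have "B' i j = - B' j i"
      using skew ij unfolding skew_symmetric_def by blast
    then show "snd t (p i) (p j) = (if j = Suc i then B' i (Suc i)
        else if i = Suc j then - B' j (Suc j) else 0)"
      using entry[OF ij] B'[OF ij] t(2) by auto
  qed
  moreover have "\<bar>B' i (Suc i)\<bar> = 1" if "1 \<le> i" "i < n" for i
    using entry[of i "Suc i"] that by simp
  ultimately obtain u where u: "u \<in> reachable_seeds n t" "path_matrix n p (\<lambda>_. 1) (snd u)"
    using path_orient[OF p] by blast
  then have reach: "u \<in> reachable_seeds n (x, B)"
    using t(1) reachable_seeds_trans by blast
  then have "good_seed n (fst u, snd u)"
    using good_seed_reachable[OF _ good] by simp
  then obtain X where "inj_on X (diagonals (n + 3))"
    "cluster_complex n (fst u, snd u) = (\<lambda>S. X ` S) ` polygon_complex (n + 3)"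
    using linear_cluster_complex[OF _ p u(2)] by metis
  then show ?thesis
    using that cluster_complex_reachable[OF reach good] by simp
qed

lemma linear_quiver_path_matrix:
  assumes skew: "skew_symmetric n B" and iso: "digraph_iso (quiver n B) (linear_quiver n)"
  obtains p where "bij_betw p {1..n} {1..n}" "path_matrix n p (\<lambda>_. 1) B"
proof -
  obtain f where f: "pre_digraph.digraph_isomorphism (quiver n B) f"
    and app: "linear_quiver n = app_iso f (quiver n B)"
    using iso unfolding digraph_iso_def by blast
  let ?v = "iso_verts f" and ?g = "iso_arcs f"
  have verts: "?v ` {1..n} = {1..n}" and arcs: "?g ` arcs (quiver n B) = {1..<n}"
    and tail: "iso_tail f = (\<lambda>i. i)" and head: "iso_head f = Suc"
    using app by (auto simp: linear_quiver_def app_iso_def quiver_def)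
  have inj: "inj_on ?v {1..n}" "inj_on ?g (arcs (quiver n B))"
    using f by (simp_all add: pre_digraph.digraph_isomorphism_def quiver_def)
  have arc: "?v i = ?g (i, j, m)" "?v j = Suc (?g (i, j, m))" if "(i, j, m) \<in> arcs (quiver n B)" for i j m
    using f that tail head by (auto simp: pre_digraph.digraph_isomorphism_def quiver_def)
  have arcs_iff: "(i, j, m) \<in> arcs (quiver n B) \<longleftrightarrow> i \<in> {1..n} \<and> j \<in> {1..n} \<and> int m < B i j" for i j m
    by (simp add: quiver_def)
  have pos: "?v j = Suc (?v i)" "B i j = 1" if "i \<in> {1..n}" "j \<in> {1..n}" "B i j > 0" for i j
  proof -
    have 0: "(i, j, 0) \<in> arcs (quiver n B)"
      using that arcs_iff by simp
    then show "?v j = Suc (?v i)"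
      using arc by metis
    \<comment> \<open>In the linear quiver an arc equals its tail, so a second arrow from
      \<open>i\<close> to \<open>j\<close> would have the same image as the first, against
      injectivity on arcs.\<close>
    have "(i, j, 1) \<notin> arcs (quiver n B)"
      using arc(1)[OF 0] arc(1)[of i j 1] 0 inj(2) by (auto dest: inj_onD)
    then show "B i j = 1"
      using that arcs_iff by auto
  qed
  have v: "bij_betw ?v {1..n} {1..n}"
    using verts inj(1) by (simp add: bij_betw_def)
  \<comment> \<open>Surjectivity on arcs supplies an arrow whose tail has position
    \<open>?v i\<close>, and injectivity on vertices identifies its end points with \<open>i\<close>
    and \<open>j\<close>.\<close>
  have step: "B i j = 1" if ij: "i \<in> {1..n}" "j \<in> {1..n}" "?v j = Suc (?v i)" for i j
  proof -
    have "?v i \<in> {1..<n}"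
      using verts ij by (metis Suc_le_eq atLeastAtMost_iff atLeastLessThan_iff imageI)
    then obtain i' j' m where a: "(i', j', m) \<in> arcs (quiver n B)" "?g (i', j', m) = ?v i"
      using arcs by (metis imageE prod_cases3)
    then have "i' \<in> {1..n}" "j' \<in> {1..n}" "B i' j' > 0" "?v i' = ?v i" "?v j' = ?v j"
      using arc[OF a(1)] arcs_iff[of i' j' m] ij(3) by auto
    then show ?thesis
      using pos(2)[of i' j'] inj(1) ij by (metis inj_onD)
  qed
  \<comment> \<open>The isomorphism sends an index to its position; the listing of indices along the
    path is its inverse.\<close>
  let ?p = "inv_into {1..n} ?v"
  have p: "bij_betw ?p {1..n} {1..n}"
    by (rule bij_betw_inv_into[OF v])
  have "path_matrix n ?p (\<lambda>_. 1) B"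
    unfolding path_matrix_def
  proof (intro ballI)
    fix i j
    assume ij: "i \<in> {1..n}" "j \<in> {1..n}"
    have vp: "?v (?p i) = i" "?v (?p j) = j"
      using bij_betw_inv_into_right[OF v] ij by auto
    have pij: "?p i \<in> {1..n}" "?p j \<in> {1..n}"
      using p ij bij_betwE by blast+
    have sk: "B (?p i) (?p j) = - B (?p j) (?p i)"
      using skew pij unfolding skew_symmetric_def by blast
    have fwd: "j = Suc i \<and> B (?p i) (?p j) = 1" if "B (?p i) (?p j) > 0"
      using pos[OF pij that] vp by simp
    have bwd: "i = Suc j \<and> B (?p j) (?p i) = 1" if "B (?p j) (?p i) > 0"
      using pos[OF pij(2,1) that] vp by simp
    have adj: "j = Suc i \<Longrightarrow> B (?p i) (?p j) = 1" "i = Suc j \<Longrightarrow> B (?p j) (?p i) = 1"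
      using step[OF pij] step[OF pij(2,1)] vp by simp_all
    show "B (?p i) (?p j) = (if j = Suc i then 1 else if i = Suc j then - 1 else 0)"
    proof (cases "B (?p i) (?p j)" "0 :: int" rule: linorder_cases)
      case less
      then have "i = Suc j" "B (?p j) (?p i) = 1"
        using bwd sk by linarith+
      moreover from this have "B (?p i) (?p j) = - 1"
        using sk by linarith
      ultimately show ?thesis
        by simp
    next
      case equal
      then show ?thesis
        using adj sk by (metis neg_equal_0_iff_equal one_neq_zero)
    next
      case greater
      then show ?thesis
        using fwd by auto
    qed
  qed
  with p show ?thesis
    using that by blast
qed

section \<open>The positive complex as a cone\<close>

text \<open>It then suffices to present both complexes as injective labelings of one family of
  sets.\<close>

lemma complex_isomorphic_images:
  assumes f: "inj_on f (\<Union>K)" and g: "inj_on g (\<Union>K)"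
  shows "complex_isomorphic ((\<lambda>\<sigma>. f ` \<sigma>) ` K) ((\<lambda>\<sigma>. g ` \<sigma>) ` K)"
proof -
  let ?h = "g \<circ> inv_into (\<Union>K) f"
  have verts: "vertices ((\<lambda>\<sigma>. f ` \<sigma>) ` K) = f ` \<Union>K" "vertices ((\<lambda>\<sigma>. g ` \<sigma>) ` K) = g ` \<Union>K"
    by (auto simp: vertices_def)
  have "bij_betw (inv_into (\<Union>K) f) (f ` \<Union>K) (\<Union>K)"
    by (rule bij_betw_inv_into) (use f in \<open>simp add: bij_betw_def\<close>)
  then have "bij_betw ?h (f ` \<Union>K) (g ` \<Union>K)"
    by (rule bij_betw_trans) (use g in \<open>simp add: bij_betw_def\<close>)
  moreover have "?h ` f ` \<sigma> = g ` \<sigma>" if "\<sigma> \<in> K" for \<sigma>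
  proof -
    have "?h (f v) = g v" if "v \<in> \<sigma>" for v
      using inv_into_f_f[OF f UnionI[OF \<open>\<sigma> \<in> K\<close> that]] by simp
    then show ?thesis
      by (auto simp: image_image)
  qed
  then have "(\<lambda>\<sigma>. ?h ` \<sigma>) ` (\<lambda>\<sigma>. f ` \<sigma>) ` K = (\<lambda>\<sigma>. g ` \<sigma>) ` K"
    by (subst image_image) (rule image_cong, auto simp del: image_comp)
  ultimately show ?thesis
    unfolding complex_isomorphic_def verts by blast
qed

text \<open>Diagonals outside the fan have end points in \<open>1\<close>, ..., \<open>M\<close>,
  and undoing the shift makes them chords of the \<open>M\<close>-gon. There \<open>(1, M)\<close>
  becomes the side \<open>(0, M - 1)\<close>, so it crosses none of the others and can be added or
  removed freely.\<close>

lemma fan_free_polygon_complex: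
  assumes "M \<ge> 3"
  shows "{S \<in> polygon_complex (Suc M). S \<inter> fan (Suc M) = {}} =
    (\<lambda>S. map_prod Suc Suc ` S) ` polygon_complex M \<union>
    (\<lambda>S. insert (1, M) (map_prod Suc Suc ` S)) ` polygon_complex M" (is "?L = ?R")
proof
  have cross: "crosses (map_prod Suc Suc d) (map_prod Suc Suc e) \<longleftrightarrow> crosses d e" for d e
    by (cases d; cases e) simp
  have diag: "map_prod Suc Suc d \<in> diagonals (Suc M) - fan (Suc M)"
    "\<not> crosses (1, M) (map_prod Suc Suc d)" "\<not> crosses (map_prod Suc Suc d) (1, M)"
    if "d \<in> diagonals M" for d
    using that by (cases d; auto simp: diagonals_def fan_def)+
  have top: "(1, M) \<in> diagonals (Suc M) - fan (Suc M)" "\<not> crosses (1, M) (1, M)"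
    using assms by (auto simp: diagonals_def fan_def)
  have "map_prod Suc Suc ` S \<in> ?L" "insert (1, M) (map_prod Suc Suc ` S) \<in> ?L"
    if "S \<in> polygon_complex M" for S
  proof -
    let ?U = "insert (1, M) (map_prod Suc Suc ` S)"
    have S: "S \<subseteq> diagonals M" "noncrossing S"
      using that by (auto simp: polygon_complex_def)
    have "?U \<subseteq> diagonals (Suc M) - fan (Suc M)"
      using top(1) by (intro insert_subsetI image_subsetI diag(1) subsetD[OF S(1)])
    moreover have "noncrossing ?U"
      unfolding noncrossing_def
    proof (intro ballI)
      fix e f
      assume e: "e \<in> ?U" and f: "f \<in> ?U"
      from e show "\<not> crosses e f"
      proof (elim insertE imageE)
        assume "e = (1, M)"
        with f show ?thesis
          by (elim insertE imageE) (simp_all only: diag(2) top(2) subsetD[OF S(1)] not_False_eq_True)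
      next
        fix d
        assume d: "d \<in> S" "e = map_prod Suc Suc d"
        from f show ?thesis
        proof (elim insertE imageE)
          assume "f = (1, M)"
          with d show ?thesis
            using S(1) diag(3) by blast
        next
          fix d'
          assume "d' \<in> S" "f = map_prod Suc Suc d'"
          with d show ?thesis
            using S(2) by (simp add: cross noncrossing_def del: crosses.simps)
        qed
      qed
    qed
    ultimately show "?U \<in> ?L"
      unfolding polygon_complex_def by blast
    then show "map_prod Suc Suc ` S \<in> ?L"
      unfolding polygon_complex_def noncrossing_def by blast
  qed
  then show "?R \<subseteq> ?L"
    by (intro Un_least image_subsetI)
  show "?L \<subseteq> ?R"
  proof
    fix S
    assume "S \<in> ?L"
    then have S: "S \<subseteq> diagonals (Suc M)" "noncrossing S" "S \<inter> fan (Suc M) = {}"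
      by (auto simp: polygon_complex_def)
    define S' where "S' = {d \<in> diagonals M. map_prod Suc Suc d \<in> S}"
    have "S' \<in> polygon_complex M"
      using S(2) cross unfolding S'_def polygon_complex_def noncrossing_def by blast
    moreover have "S - {(1, M)} = map_prod Suc Suc ` S' - {(1, M)}"
    proof
      show "S - {(1, M)} \<subseteq> map_prod Suc Suc ` S' - {(1, M)}"
      proof
        fix d
        assume d: "d \<in> S - {(1, M)}"
        then obtain i j where ij: "d = (i, j)" "Suc i < j" "j < Suc M" "(i, j) \<noteq> (0, M)"
          using S(1) by (cases d) (auto simp: diagonals_def)
        have "i \<noteq> 0"
        proof
          assume "i = 0"
          then have "d \<in> fan (Suc M)"
            using ij by (auto simp: fan_def)
          then show False
            using S(3) d by blast
        qed
        then have "d = map_prod Suc Suc (i - 1, j - 1)" "(i - 1, j - 1) \<in> diagonals M"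
          using ij d by (auto simp: diagonals_def)
        then show "d \<in> map_prod Suc Suc ` S' - {(1, M)}"
          using d by (auto simp: S'_def)
      qed
    qed (auto simp: S'_def)
    moreover have "(1, M) \<notin> map_prod Suc Suc ` S'"
      by (auto simp: S'_def diagonals_def)
    ultimately have S': "S' \<in> polygon_complex M" "S - {(1, M)} = map_prod Suc Suc ` S'"
      by auto
    show "S \<in> ?R"
    proof (cases "(1, M) \<in> S")
      case True
      then have "S = insert (1, M) (map_prod Suc Suc ` S')"
        using S'(2) by auto
      then show ?thesis
        using S'(1) by (intro UnI2) (rule image_eqI)
    next
      case False
      then have "S = map_prod Suc Suc ` S'"
        using S'(2) by simp
      then show ?thesis
        using S'(1) by (intro UnI1) (rule image_eqI)
    qed
  qed
qed

theorem theorem4p4: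
  fixes n :: nat
    and F :: "'a::field_char_0 set" and x :: "nat \<Rightarrow> 'a" and B :: int_matrix
    and G :: "'b::field_char_0 set" and y :: "nat \<Rightarrow> 'b" and C :: int_matrix
  assumes "n \<ge> 1"
    and "labeled_seed F n (x, B)"
    and "A_type n B"
    and "skew_symmetric n B"
    and "digraph_iso (quiver n B) (linear_quiver n)"
    and "labeled_seed G (n - 1) (y, C)"
    and "A_type (n - 1) C"
  shows "complex_isomorphic (positive_cluster_complex n (x, B))
           (cone (cluster_complex (n - 1) (y, C)))"
proof -
  \<comment> \<open>The given seed lives on the polygon with \<open>Suc M\<close> vertices, the one
    of rank \<open>n - 1\<close> on the polygon with \<open>M\<close> vertices.\<close>
  define M where "M = n + 2"
  have M: "M \<ge> 3" "n + 3 = Suc M" "n - 1 + 3 = M"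
    using \<open>n \<ge> 1\<close> by (auto simp: M_def)
  obtain p where p: "bij_betw p {1..n} {1..n}" "path_matrix n p (\<lambda>_. 1) B"
    using linear_quiver_path_matrix[OF assms(4,5)] .
  obtain X where X: "inj_on X (diagonals (Suc M))" "x ` {1..n} = X ` fan (Suc M)"
    "cluster_complex n (x, B) = (\<lambda>S. X ` S) ` polygon_complex (Suc M)"
    using linear_cluster_complex[OF labeled_seed_good[OF assms(2)] p] unfolding M .
  obtain Y where Y: "inj_on Y (diagonals M)"
    "cluster_complex (n - 1) (y, C) = (\<lambda>S. Y ` S) ` polygon_complex M"
    using A_type_cluster_complex[OF labeled_seed_good[OF assms(6)] assms(7)] unfolding M .
  define K where "K = {S \<in> polygon_complex (Suc M). S \<inter> fan (Suc M) = {}}"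
  have fan: "fan (Suc M) \<subseteq> diagonals (Suc M)"
    using triangulation_fan by (auto simp: triangulation_def polygon_complex_def)
  \<comment> \<open>Injectivity of \<open>X\<close> turns avoiding the initial variables in the
    field into avoiding the fan among diagonals.\<close>
  have "X ` S \<inter> X ` fan (Suc M) = {} \<longleftrightarrow> S \<inter> fan (Suc M) = {}" if "S \<in> polygon_complex (Suc M)" for S
    using inj_on_image_Int[OF X(1) _ fan, of S] that by (auto simp: polygon_complex_def)
  then have positive: "positive_cluster_complex n (x, B) = (\<lambda>S. X ` S) ` K"
    unfolding positive_cluster_complex_def full_subcomplex_def vertices_def X(3) K_def fst_conv X(2)
    by blast
  \<comment> \<open>The chord \<open>(1, M)\<close> goes to the cone vertex, and on the rest the
    shift by \<open>Suc\<close> is undone. Truncated subtraction is harmless, as no diagonal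
    occurring in \<open>K\<close> starts at \<open>0\<close>.\<close>
  define Z where "Z d = (if d = (1, M) then None else Some (Y (fst d - 1, snd d - 1)))" for d :: "nat \<times> nat"
  have Z_Suc: "Z (map_prod Suc Suc d) = Some (Y d)" if "d \<in> diagonals M" for d
    using that M(1) by (auto simp: Z_def diagonals_def)
  have K: "K = (\<lambda>S. map_prod Suc Suc ` S) ` polygon_complex M \<union>
      (\<lambda>S. insert (1, M) (map_prod Suc Suc ` S)) ` polygon_complex M"
    unfolding K_def by (rule fan_free_polygon_complex[OF M(1)])
  have Z_image: "Z ` map_prod Suc Suc ` S = Some ` Y ` S" if "S \<in> polygon_complex M" for S
    unfolding image_image by (rule image_cong) (use that Z_Suc in \<open>auto simp: polygon_complex_def\<close>)
  have "Z (1, M) = None"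
    by (simp add: Z_def)
  then have cone: "cone (cluster_complex (n - 1) (y, C)) = (\<lambda>S. Z ` S) ` K"
    unfolding cone_def Y(2) K image_Un image_image[of _ _ "polygon_complex M"] image_insert
    using Z_image by (simp cong: image_cong)
  have vertices: "\<Union>K \<subseteq> insert (1, M) (map_prod Suc Suc ` diagonals M)"
    unfolding K by (auto simp: polygon_complex_def)
  have "inj_on Z (\<Union>K)"
  proof (rule inj_on_subset[OF _ vertices])
    show "inj_on Z (insert (1, M) (map_prod Suc Suc ` diagonals M))"
      using Y(1) Z_Suc \<open>Z (1, M) = None\<close> by (auto simp: inj_on_def)
  qed
  moreover have "inj_on X (\<Union>K)"
    by (rule inj_on_subset[OF X(1)]) (auto simp: K_def polygon_complex_def)
  ultimately show ?thesis
    unfolding positive cone by (rule complex_isomorphic_images[rotated])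
qed

end
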